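(* Let $\mathcal{F}=\{f_j\}_{j=1}^n$ be a frame for $\mathbb{C}^d$ and set $m=2d-n$. Let $\varepsilon>0$ and $t>\operatorname{tr}(S_{\mathcal{F}^\#})$ be such that $t-\operatorname{tr}(S_{\mathcal{F}^\#})\le\min\{d-m,\,d\}\cdot\varepsilon^2$. Let $\lambda=\lambda(S_{\mathcal{F}^\#})$ and $\rho=\rho_{(t,\varepsilon^2)}(\lambda,m)$ (see context). Let $h:[0,\infty)\to[0,\infty)$ be an increasing convex function. Then $$P_h(\mathcal{G})\ \ge\ \sum_{i=1}^d h(\rho_i)\qquad\text{for every }\mathcal{G}\in\mathcal{D}_{(t,\varepsilon)}(\mathcal{F}),$$ and this lower bound is attained. If moreover $h$ is strictly convex, then $\mathcal{G}\in\mathcal{D}_{(t,\varepsilon)}(\mathcal{F})$ attains the lower bound if and only if $\mathcal{G}=\{f_i^\#+k_i\}_{i=1}^n$ for some $\mathcal{K}=\{k_i\}_{i=1}^n$ such that $T_{\mathcal{F}}^*T_{\mathcal{K}}=0$ and such that there exists an orthonormal basis $\{v_j\}_{j=1}^d$ of $\mathbb{C}^d$ with $$S_{\mathcal{F}^\#}=\sum_{j=1}^d\lambda_j\, v_j\otimes v_j\quad\text{and}\quad S_{\mathcal{K}}=\sum_{j=1}^d(\rho-\lambda)_j\, v_j\otimes v_j .$$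
   Context: For a finite sequence $\mathcal{F}=\{f_i\}_{i=1}^n$ in $\mathbb{C}^d$, the analysis operator $T_{\mathcal{F}}:\mathbb{C}^d\to\mathbb{C}^n$ is $T_{\mathcal{F}}x=(\langle x,f_i\rangle)_{i=1}^n$, and the frame operator is $S_{\mathcal{F}}=T_{\mathcal{F}}^*T_{\mathcal{F}}=\sum_{i=1}^n f_i\otimes f_i$, where $(x\otimes y)(z)=\langle z,y\rangle x$. $\mathcal{F}$ is a frame for $\mathbb{C}^d$ iff it spans $\mathbb{C}^d$. A dual frame of $\mathcal{F}$ is a sequence $\mathcal{G}=\{g_i\}_{i=1}^n$ in $\mathbb{C}^d$ with $T_{\mathcal{F}}^*T_{\mathcal{G}}=I$; $\mathcal{D}(\mathcal{F})$ is the set of dual frames. The canonical dual is $\mathcal{F}^\#=\{f_i^\#\}_{i=1}^n$ with $f_i^\#=S_{\mathcal{F}}^{-1}f_i$. Define $$\mathcal{D}_{(t,\varepsilon)}(\mathcal{F})=\Big\{\mathcal{G}=\{g_j\}_{j=1}^n\in\mathcal{D}(\mathcal{F}):\ \sum_{j=1}^n\|g_j\|^2\ge t,\ \|T_{\mathcal{G}}-T_{\mathcal{F}^\#}\|\le\varepsilon\Big\}$$ with $\|\cdot\|$ on operators the spectral norm. The convex potential associated with $h$ is $P_h(\mathcal{G})=\operatorname{tr}h(S_{\mathcal{G}})=\sum_{i=1}^d h(\lambda_i(S_{\mathcal{G}}))$. For a positive semidefinite $d\times d$ matrix $S$, $\lambda(S)=(\lambda_i(S))_{i=1}^d$ is the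 vector of eigenvalues counted with multiplicity in non-increasing order. For $x\in\mathbb{R}^d$, $x^\downarrow$ (resp. $x^\uparrow$) is its rearrangement in non-increasing (resp. non-decreasing) order and $\operatorname{tr}x=\sum_i x_i$. Submajorization: $x\prec_w y$ means $\sum_{i=1}^k x_i^\downarrow\le\sum_{i=1}^k y_i^\downarrow$ for all $1\le k\le d$. For $\lambda\in\mathbb{R}^d$ with $\lambda=\lambda^\downarrow$, $\eta>0$, an integer $m\le d-1$, and $t\ge\operatorname{tr}\lambda$ with $t-\operatorname{tr}\lambda\le\min\{d-m,d\}\cdot\eta$, let $$\Lambda_{(t,\eta)}(\lambda,m)=\{\lambda+\mu:\ \mu\in\mathbb{R}^d,\ 0\le\mu_i\le\eta\ \forall i,\ \operatorname{tr}\mu\ge t-\operatorname{tr}\lambda,\ \#\{j:\mu_j\ne0\}\le d-m\}.$$ The vector $\rho_{(t,\eta)}(\lambda,m)$ denotes the unique $\rho\in\Lambda_{(t,\eta)}(\lambda,m)$ such that $\operatorname{tr}\rho=t$, $\rho\prec_w\gamma$ for every $\gamma\in\Lambda_{(t,\eta)}(\lambda,m)$, and $\rho-\lambda=(\rho-\lambda)^\uparrow$ (such a $\rho$ exists and is unique). *)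

theory Defs
  imports "HOL-Analysis.Analysis" "HOL-Computational_Algebra.Polynomial"
begin

text \<open>
  The space \<open>\<complex>\<^sup>d\<close> is \<open>complex^'d\<close> with \<open>d = CARD('d)\<close>, and a sequence of \<open>n\<close> vectors is a function
  \<open>'n \<Rightarrow> complex^'d\<close> with \<open>n = CARD('n)\<close>. Vectors of \<open>\<real>\<^sup>d\<close> whose entries are ordered (spectra and the
  like) are lists of length \<open>d\<close>, so entry number \<open>i\<close> is \<open>x ! (i - 1)\<close>.
\<close>

text \<open>The library's \<open>inner\<close> on \<open>complex^'d\<close> is the real part of the following.\<close>

definition cinner :: "complex^'d \<Rightarrow> complex^'d \<Rightarrow> complex" where
  "cinner x y = (\<Sum>i\<in>UNIV. x $ i * cnj (y $ i))"

definition cadjoint :: "complex^'d^'n \<Rightarrow> complex^'n^'d" where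
  "cadjoint A = (\<chi> i j. cnj (A $ j $ i))"

lemma cinner_cadjoint:
  fixes A :: "complex^'d^'n"
  shows "cinner (A *v x) y = cinner x (cadjoint A *v y)"
  unfolding cinner_def cadjoint_def matrix_vector_mult_def
  by (simp add: sum_distrib_left sum_distrib_right mult_ac) (rule sum.swap)

definition tensor :: "complex^'d \<Rightarrow> complex^'d \<Rightarrow> complex^'d^'d" where
  "tensor x y = (\<chi> i j. x $ i * cnj (y $ j))"

lemma tensor_mult: "tensor x y *v z = cinner z y *s x"
  by (simp add: vec_eq_iff tensor_def cinner_def matrix_vector_mult_def sum_distrib_left
      sum_distrib_right mult_ac)

text \<open>The operator norm \<open>onorm\<close> is taken with respect to the Euclidean norms.\<close>

definition spectral_norm :: "complex^'d^'n \<Rightarrow> real" where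
  "spectral_norm A = onorm ((*v) A)"

definition charpoly :: "complex^'d^'d \<Rightarrow> complex poly" where
  "charpoly A = det (\<chi> i j. (if i = j then [:0, 1:] else 0) - [:A $ i $ j:])"

text \<open>
  The eigenvalues, counted with multiplicity and listed in non-increasing order. Taking real parts
  changes nothing for the Hermitian matrices to which this is applied.
\<close>

definition eigvals :: "complex^'d^'d \<Rightarrow> real list" where
  "eigvals A = rev (sorted_list_of_multiset (image_mset Re (proots (charpoly A))))"

definition orthonormal_basis :: "(nat \<Rightarrow> complex^'d) \<Rightarrow> bool" where
  "orthonormal_basis v \<longleftrightarrow>
     (\<forall>i<CARD('d). \<forall>j<CARD('d). cinner (v i) (v j) = (if i = j then 1 else 0)) \<and>
     vec.span (v ` {..<CARD('d)}) = UNIV"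

definition is_frame :: "('n::finite \<Rightarrow> complex^'d) \<Rightarrow> bool" where
  "is_frame F \<longleftrightarrow> vec.span (range F) = UNIV"

definition analysis_op :: "('n::finite \<Rightarrow> complex^'d) \<Rightarrow> complex^'d^'n" where
  "analysis_op F = (\<chi> i j. cnj (F i $ j))"

lemma analysis_op_mult: "analysis_op F *v x = (\<chi> i. cinner x (F i))"
  by (simp add: vec_eq_iff analysis_op_def cinner_def matrix_vector_mult_def mult_ac)

definition frame_op :: "('n::finite \<Rightarrow> complex^'d) \<Rightarrow> complex^'d^'d" where
  "frame_op F = cadjoint (analysis_op F) ** analysis_op F"

lemma frame_op_eq_sum: "frame_op F = (\<Sum>i\<in>UNIV. tensor (F i) (F i))"
  by (simp add: vec_eq_iff frame_op_def cadjoint_def analysis_op_def tensor_def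
      matrix_matrix_mult_def)

definition dual_frames :: "('n::finite \<Rightarrow> complex^'d) \<Rightarrow> ('n \<Rightarrow> complex^'d) set" where
  "dual_frames F = {G. cadjoint (analysis_op F) ** analysis_op G = mat 1}"

definition canonical_dual :: "('n::finite \<Rightarrow> complex^'d) \<Rightarrow> 'n \<Rightarrow> complex^'d" where
  "canonical_dual F i = matrix_inv (frame_op F) *v F i"

definition restricted_duals ::
    "real \<Rightarrow> real \<Rightarrow> ('n::finite \<Rightarrow> complex^'d) \<Rightarrow> ('n \<Rightarrow> complex^'d) set" where
  "restricted_duals t \<epsilon> F =
     {G \<in> dual_frames F. (\<Sum>j\<in>UNIV. (norm (G j))\<^sup>2) \<ge> t \<and>
        spectral_norm (analysis_op G - analysis_op (canonical_dual F)) \<le> \<epsilon>}"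

definition convex_potential :: "(real \<Rightarrow> real) \<Rightarrow> ('n::finite \<Rightarrow> complex^'d) \<Rightarrow> real" where
  "convex_potential h G = sum_list (map h (eigvals (frame_op G)))"

definition decr :: "real list \<Rightarrow> real list" where
  "decr x = rev (sort x)"

definition submajorized :: "real list \<Rightarrow> real list \<Rightarrow> bool" where
  "submajorized x y \<longleftrightarrow> length x = length y \<and>
     (\<forall>k\<in>{1..length x}. sum_list (take k (decr x)) \<le> sum_list (take k (decr y)))"

text \<open>The parameter \<open>m\<close> may be negative, hence an integer.\<close>

definition Lambda_set :: "real \<Rightarrow> real \<Rightarrow> real list \<Rightarrow> int \<Rightarrow> real list set" where
  "Lambda_set t \<eta> lam m =
     {map2 (+) lam \<mu> | \<mu>. length \<mu> = length lam \<and>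
        (\<forall>i<length \<mu>. 0 \<le> \<mu> ! i \<and> \<mu> ! i \<le> \<eta>) \<and>
        sum_list \<mu> \<ge> t - sum_list lam \<and>
        int (card {j. j < length \<mu> \<and> \<mu> ! j \<noteq> 0}) \<le> int (length lam) - m}"

definition rho_vec :: "real \<Rightarrow> real \<Rightarrow> real list \<Rightarrow> int \<Rightarrow> real list" where
  "rho_vec t \<eta> lam m =
     (THE \<rho>. \<rho> \<in> Lambda_set t \<eta> lam m \<and> sum_list \<rho> = t \<and>
        (\<forall>\<gamma>\<in>Lambda_set t \<eta> lam m. submajorized \<rho> \<gamma>) \<and>
        sorted (map2 (-) \<rho> lam))"

definition strictly_convex_on :: "real set \<Rightarrow> (real \<Rightarrow> real) \<Rightarrow> bool" where
  "strictly_convex_on S h \<longleftrightarrow> convex S \<and>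
     (\<forall>x\<in>S. \<forall>y\<in>S. \<forall>u>0. \<forall>v>0. x \<noteq> y \<longrightarrow> u + v = 1 \<longrightarrow>
        h (u * x + v * y) < u * h x + v * h y)"

end

theory Submission
  imports Defs
begin

text \<open>
  Write \<open>A\<close> for the frame operator of the canonical dual. A dual frame is the canonical dual plus a
  sequence \<open>K\<close> with \<open>T\<^sub>F\<^sup>* T\<^sub>K = 0\<close>. The cross terms vanish, so its frame operator is \<open>A + B\<close> with
  \<open>B = S\<^sub>K\<close>. Here \<open>B\<close> is positive semidefinite, the norm condition says \<open>B \<le> \<epsilon>\<^sup>2\<close>,
  the other condition says \<open>tr (A + B) \<ge> t\<close>, and the rank of \<open>B\<close> is at
  most \<open>n - d\<close> because the range of \<open>T\<^sub>K\<close> is orthogonal to the \<open>d\<close>-dimensional range of \<open>T\<^sub>F\<close>. Conversely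
  every such \<open>B\<close> comes from some \<open>K\<close>. Hence the theorem is about minimizing \<open>tr h (A + B)\<close> over
  these \<open>B\<close> (\<open>restricted_dual_cases\<close>, \<open>restricted_dual_exists\<close>).

  Lower bound. Lidskii's inequality says that \<open>\<gamma>\<close>, the sum of the decreasing spectrum of \<open>A\<close> and the
  increasing spectrum of \<open>B\<close>, is submajorized by the spectrum of \<open>A + B\<close>
  (\<open>lidskii_submajorization\<close>). The constraints on \<open>B\<close> say that \<open>\<gamma>\<close> lies in the set in which \<open>\<rho>\<close> is
  minimal, so \<open>\<rho>\<close> is submajorized by the spectrum of \<open>A + B\<close>, and increasing convex functions respect
  submajorization (\<open>sum_le_if_submajorized\<close>). The bound is attained by the \<open>B\<close> that is diagonal in an
  eigenbasis of \<open>A\<close> with eigenvalues \<open>\<rho> - \<lambda>\<close>.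

  Submajorization is used in the form of the inequalities \<open>\<Sum> max 0 (x\<^sub>i - s) \<le> \<Sum> max 0 (y\<^sub>i - s)\<close>, one for each
  real \<open>s\<close>. In this form Lidskii's inequality reduces to the monotonicity of eigenvalues, and the
  minimality of \<open>\<rho>\<close>, which fills \<open>\<lambda>\<close> up to a water level \<open>c\<close> with increments capped at \<open>\<epsilon>\<^sup>2\<close>, splits into
  the cases \<open>c \<le> s\<close> and \<open>s < c\<close>.

  Equality. If \<open>h\<close> is strictly convex and the bound is attained, then \<open>A + B\<close> has spectrum \<open>\<rho>\<close> up to order,
  hence so has \<open>\<gamma>\<close>, which lies between the two. Since \<open>\<gamma>\<close> and the spectrum of \<open>A + B\<close> have the same
  sum of squares, \<open>tr (A B) = \<Sum> \<lambda>\<^sub>i(A) \<lambda>\<^sub>d\<^sub>+\<^sub>1\<^sub>-\<^sub>i(B)\<close>, which is the least value that the trace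
  can have for the given spectra. This forces \<open>A\<close> and \<open>B\<close> to commute and to have a common eigenbasis in which their
  eigenvalues are oppositely ordered (\<open>lidskii_equality\<close>). Finally \<open>\<gamma> = \<rho>\<close> because the optimal vector is
  unique (\<open>optimal_spectrum_unique\<close>).
\<close>

section \<open>Submajorization and convex functions\<close>

lemma mset_decr [simp]: "mset (decr xs) = mset xs"
  by (simp add: decr_def)

lemma length_decr [simp]: "length (decr xs) = length xs"
  by (simp add: decr_def)

lemma decr_cong: "mset xs = mset ys \<Longrightarrow> decr xs = decr ys"
  unfolding decr_def by (simp add: properties_for_sort)

lemma decr_eq_iff: "decr xs = decr ys \<longleftrightarrow> mset xs = mset ys"
  by (metis decr_cong mset_decr)

lemma sum_list_map_mset_cong:
  "mset xs = mset ys \<Longrightarrow> sum_list (map f xs) = sum_list (map f ys :: real list)"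
  by (simp flip: sum_mset_sum_list)

lemma sorted_wrt_decr: "sorted_wrt (\<ge>) (decr xs)"
  by (simp add: decr_def sorted_wrt_rev)

lemma decr_ident: "sorted_wrt (\<ge>) xs \<Longrightarrow> decr xs = xs"
  unfolding decr_def
  using properties_for_sort[of "rev xs" xs] by (simp add: sorted_wrt_rev)

lemma sum_list_take_nth: "k \<le> length xs \<Longrightarrow> sum_list (take k xs) = (\<Sum>i<k. xs ! i)"
  by (simp add: sum_list_sum_nth atLeast0LessThan)

definition hinge_sum :: "real \<Rightarrow> real list \<Rightarrow> real" where
  "hinge_sum s xs = (\<Sum>x\<leftarrow>xs. max 0 (x - s))"

lemma hinge_sum_mset_cong: "mset xs = mset ys \<Longrightarrow> hinge_sum s xs = hinge_sum s ys"
  unfolding hinge_sum_def by (rule sum_list_map_mset_cong)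

lemma hinge_sum_nonneg: "0 \<le> hinge_sum s xs"
  unfolding hinge_sum_def by (intro sum_list_nonneg) auto

lemma hinge_sum_append: "hinge_sum s (xs @ ys) = hinge_sum s xs + hinge_sum s ys"
  by (simp add: hinge_sum_def)

lemma sum_list_le_hinge_sum: "sum_list xs \<le> real (length xs) * s + hinge_sum s xs"
  unfolding hinge_sum_def by (induction xs) (auto simp: algebra_simps)

lemma take_sum_le_hinge_sum:
  assumes "k \<le> length xs"
  shows "sum_list (take k xs) \<le> real k * s + hinge_sum s xs"
proof -
  have "sum_list (take k xs) \<le> real k * s + hinge_sum s (take k xs)"
    using sum_list_le_hinge_sum[of "take k xs" s] assms by simp
  also have "hinge_sum s (take k xs) \<le> hinge_sum s xs"
    using hinge_sum_append[of s "take k xs" "drop k xs"] hinge_sum_nonneg[of s "drop k xs"] by simp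
  finally show ?thesis by simp
qed

lemma hinge_sum_eq_0: "(\<And>x. x \<in> set xs \<Longrightarrow> x \<le> s) \<Longrightarrow> hinge_sum s xs = 0"
  unfolding hinge_sum_def by (induction xs) auto

lemma hinge_sum_all_ge: "(\<And>x. x \<in> set xs \<Longrightarrow> s \<le> x) \<Longrightarrow> hinge_sum s xs = sum_list xs - real (length xs) * s"
  unfolding hinge_sum_def by (induction xs) (auto simp: algebra_simps)

text \<open>
  On a decreasing list the entries that contribute to the hinge sum form an initial segment.
\<close>

lemma hinge_sum_eq_take_sum:
  assumes "sorted_wrt (\<ge>) xs"
  obtains k where "k \<le> length xs" "hinge_sum s xs = sum_list (take k xs) - real k * s"
proof -
  have "\<exists>k\<le>length xs. hinge_sum s xs = sum_list (take k xs) - real k * s"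
    using assms
  proof (induction xs)
    case Nil
    then show ?case by (simp add: hinge_sum_def)
  next
    case (Cons y ys)
    show ?case
    proof (cases "y \<le> s")
      case True
      then have "hinge_sum s (y # ys) = 0"
        using Cons.prems by (intro hinge_sum_eq_0) auto
      then show ?thesis by (intro exI[of _ 0]) simp
    next
      case False
      obtain k where k: "k \<le> length ys" "hinge_sum s ys = sum_list (take k ys) - real k * s"
        using Cons by auto
      then show ?thesis using False
        by (intro exI[of _ "Suc k"]) (auto simp: hinge_sum_def algebra_simps)
    qed
  qed
  then show ?thesis using that by blast
qed

text \<open>
  With \<open>s\<close> equal to the \<open>k\<close>-th largest entry, the bound \<open>take_sum_le_hinge_sum\<close> is sharp: the first
  \<open>k\<close> entries lie above \<open>s\<close> and the others do not contribute.
\<close>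

lemma take_sum_eq_hinge_sum:
  assumes "sorted_wrt (\<ge>) xs" "1 \<le> k" "k \<le> length xs"
  shows "sum_list (take k xs) = real k * (xs ! (k - 1)) + hinge_sum (xs ! (k - 1)) xs"
proof -
  let ?s = "xs ! (k - 1)"
  have "hinge_sum ?s (take k xs) = sum_list (take k xs) - length (take k xs) * ?s"
  proof (rule hinge_sum_all_ge)
    fix x assume "x \<in> set (take k xs)"
    then obtain i where "i < k" "x = xs ! i" using assms(3) by (auto simp: in_set_conv_nth)
    then show "?s \<le> x" using assms sorted_wrt_nth_less[OF assms(1), of i "k-1"]
      by (cases "i = k - 1") auto
  qed
  moreover have "hinge_sum ?s (drop k xs) = 0"
  proof (rule hinge_sum_eq_0)
    fix x assume "x \<in> set (drop k xs)"
    then obtain i where "k + i < length xs" "x = xs ! (k + i)"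
      using assms(3) by (auto simp: set_conv_nth less_diff_conv add.commute)
    then show "x \<le> ?s" using assms sorted_wrt_nth_less[OF assms(1), of "k-1" "k+i"] by auto
  qed
  ultimately show ?thesis
    using hinge_sum_append[of ?s "take k xs" "drop k xs"] assms(3) by simp
qed

text \<open>
  The criterion of Hardy, Littlewood and Polya. The partial sums of a list \<open>y\<close> and its hinge sums
  determine each other by duality: \<open>k * s + hinge_sum s y\<close> bounds the \<open>k\<close>-th partial sum for every \<open>s\<close>, with equality
  for a suitable \<open>s\<close>, and conversely. The hinge sums do not mention the order of the entries, which
  makes them the more convenient of the two.
\<close>

lemma submajorized_iff_hinge_sum:
  "submajorized x y \<longleftrightarrow> length x = length y \<and> (\<forall>s. hinge_sum s x \<le> hinge_sum s y)"
proof (intro iffI conjI allI)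
  assume xy: "submajorized x y"
  then show len: "length x = length y" by (simp add: submajorized_def)
  fix s
  obtain k where k: "k \<le> length (decr x)"
      "hinge_sum s (decr x) = sum_list (take k (decr x)) - real k * s"
    using hinge_sum_eq_take_sum[OF sorted_wrt_decr] by blast
  have "sum_list (take k (decr x)) \<le> sum_list (take k (decr y))"
    using xy k(1) unfolding submajorized_def by (cases "k = 0") auto
  also have "\<dots> \<le> real k * s + hinge_sum s (decr y)"
    using k(1) len by (intro take_sum_le_hinge_sum) simp
  finally show "hinge_sum s x \<le> hinge_sum s y"
    using k(2) hinge_sum_mset_cong[of "decr x" x] hinge_sum_mset_cong[of "decr y" y] by simp
next
  assume *: "length x = length y \<and> (\<forall>s. hinge_sum s x \<le> hinge_sum s y)"
  show "submajorized x y"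
    unfolding submajorized_def
  proof (intro conjI ballI)
    show "length x = length y" using * by simp
    fix k assume k: "k \<in> {1..length x}"
    let ?s = "decr y ! (k - 1)"
    have "sum_list (take k (decr x)) \<le> real k * ?s + hinge_sum ?s (decr x)"
      using k by (intro take_sum_le_hinge_sum) simp
    also have "hinge_sum ?s (decr x) \<le> hinge_sum ?s (decr y)"
      using * hinge_sum_mset_cong[of "decr x" x] hinge_sum_mset_cong[of "decr y" y] by simp
    also have "real k * ?s + \<dots> = sum_list (take k (decr y))"
      using k * by (intro take_sum_eq_hinge_sum[symmetric] sorted_wrt_decr) auto
    finally show "sum_list (take k (decr x)) \<le> sum_list (take k (decr y))" by simp
  qed
qed

lemma submajorized_trans: "submajorized x y \<Longrightarrow> submajorized y z \<Longrightarrow> submajorized x z"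
  unfolding submajorized_iff_hinge_sum by (auto intro: order_trans)

lemma submajorized_antisym: 
  assumes "submajorized x y" "submajorized y x"
  shows "mset x = mset y"
proof -
  have len: "length x = length y" using assms by (simp add: submajorized_def)
  have le: "sum_list (take k (decr u)) \<le> sum_list (take k (decr v))"
    if "submajorized u v" "k \<le> length u" for k u v
    using that unfolding submajorized_def by (cases "k = 0") simp_all
  have t: "sum_list (take k (decr x)) = sum_list (take k (decr y))" if "k \<le> length x" for k
    using le[OF assms(1), of k] le[OF assms(2), of k] that len by linarith
  have "decr x = decr y"
  proof (rule nth_equalityI)
    fix i assume i: "i < length (decr x)"
    have "sum_list (take (Suc i) (decr x)) = sum_list (take i (decr x)) + decr x ! i"
      using i by (simp add: take_Suc_conv_app_nth)
    moreover have "sum_list (take (Suc i) (decr y)) = sum_list (take i (decr y)) + decr y ! i"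
      using i len by (simp add: take_Suc_conv_app_nth)
    ultimately show "decr x ! i = decr y ! i" using t[of i] t[of "Suc i"] i by simp
  qed (use len in simp)
  then show ?thesis by (simp add: decr_eq_iff)
qed

text \<open>
  Abel summation: every decrease of the weights \<open>c\<close> multiplies a nonnegative partial sum.
\<close>

lemma summation_by_parts_ge:
  fixes c z :: "nat \<Rightarrow> real"
  assumes "\<And>i. i < d \<Longrightarrow> c (Suc i) \<le> c i" "\<And>k. k \<le> d \<Longrightarrow> 0 \<le> (\<Sum>i<k. z i)"
  shows "c d * (\<Sum>i<Suc d. z i) \<le> (\<Sum>i<Suc d. c i * z i)"
  using assms
proof (induction d)
  case 0
  then show ?case by simp
next
  case (Suc d)
  have "c (Suc d) * (\<Sum>i<Suc (Suc d). z i) = c (Suc d) * (\<Sum>i<Suc d. z i) + c (Suc d) * z (Suc d)"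
    by (simp add: algebra_simps)
  also have "\<dots> \<le> c d * (\<Sum>i<Suc d. z i) + c (Suc d) * z (Suc d)"
    using Suc.prems(1)[of d] Suc.prems(2)[of "Suc d"] by (intro add_right_mono mult_right_mono) auto
  also have "c d * (\<Sum>i<Suc d. z i) \<le> (\<Sum>i<Suc d. c i * z i)"
    using Suc by simp
  finally show ?case by simp
qed

lemma convex_on_slope_mono:
  fixes h :: "real \<Rightarrow> real"
  assumes "convex_on S h" "y \<in> S" "z \<in> S" "y < x" "x < z"
  shows "(h x - h y) / (x - y) \<le> (h z - h x) / (z - x)"
proof -
  have "(h y - h x) / (y - x) \<le> (h y - h z) / (y - z)" "(h y - h z) / (y - z) \<le> (h x - h z) / (x - z)"
    using convex_on_slope_le[OF assms] by auto
  moreover have "(h y - h x) / (y - x) = (h x - h y) / (x - y)" "(h x - h z) / (x - z) = (h z - h x) / (z - x)"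
    using minus_divide_divide[of "h x - h y" "x - y"] minus_divide_divide[of "h z - h x" "z - x"]
    by simp_all
  ultimately show ?thesis by linarith
qed

text \<open>
  The slope is the right derivative, written as the infimum of the slopes of chords to the right. For
  a nondecreasing function it is nonnegative and exists also at the end point \<open>0\<close>.
\<close>

lemma monotone_subgradient:
  fixes h :: "real \<Rightarrow> real"
  assumes mono: "mono_on {0..} h" and conv: "convex_on {0..} h"
  obtains c where "\<And>x. 0 \<le> x \<Longrightarrow> 0 \<le> c x" "\<And>x y. 0 \<le> x \<Longrightarrow> x \<le> y \<Longrightarrow> c x \<le> c y"
    "\<And>x y. 0 \<le> x \<Longrightarrow> 0 \<le> y \<Longrightarrow> h x + c x * (y - x) \<le> h y"
proof -
  define q where "q x z = (h z - h x) / (z - x)" for x z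
  \<comment> \<open>The chord slopes are bounded below by \<open>0\<close>, so the infimum is not a default value.\<close>
  define c where "c x = Inf (q x ` {x<..})" for x
  have q0: "0 \<le> q x z" if "0 \<le> x" "x < z" for x z
    using mono_onD[OF mono, of x z] that by (simp add: q_def)
  have bdd: "bdd_below (q x ` {x<..})" if "0 \<le> x" for x
    using q0 that by (intro bdd_belowI2[of _ 0]) auto
  have c0: "0 \<le> c x" if "0 \<le> x" for x
    unfolding c_def using q0 that by (intro cInf_greatest) auto
  have cq: "c x \<le> q x z" if "0 \<le> x" "x < z" for x z
    unfolding c_def using that bdd by (intro cInf_lower) auto
  have qc: "q y x \<le> c x" if "0 \<le> y" "y < x" for x y
    unfolding c_def using that convex_on_slope_mono[OF conv, of y _ x]
    by (intro cInf_greatest) (auto simp: q_def)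
  show ?thesis
  proof (rule that[of c])
    show "c x \<le> c y" if "0 \<le> x" "x \<le> y" for x y
      using cq[of x y] qc[of x y] that by (cases "x = y") auto
    show "h x + c x * (y - x) \<le> h y" if "0 \<le> x" "0 \<le> y" for x y
      using cq[of x y] qc[of y x] that
      by (cases x y rule: linorder_cases)
        (auto simp: q_def pos_le_divide_eq pos_divide_le_eq algebra_simps)
  qed (use c0 in auto)
qed

text \<open>
  With \<open>c\<close> a monotone subgradient of \<open>h\<close> and both lists in decreasing order, the difference of the two sums is at least
  \<open>\<Sum> c (x\<^sub>i) (y\<^sub>i - x\<^sub>i)\<close>, and this is nonnegative by Abel summation: the weights decrease and the partial
  sums of \<open>y\<^sub>i - x\<^sub>i\<close> are nonnegative. In case of equality every single subgradient inequality is an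
  equality, which for strictly convex \<open>h\<close> means \<open>x\<^sub>i = y\<^sub>i\<close>.
\<close>

lemma sum_le_if_submajorized:
  fixes h :: "real \<Rightarrow> real"
  assumes maj: "submajorized x y" and mono: "mono_on {0..} h" and conv: "convex_on {0..} h"
    and x0: "\<And>u. u \<in> set x \<Longrightarrow> 0 \<le> u" and y0: "\<And>u. u \<in> set y \<Longrightarrow> 0 \<le> u"
  shows "sum_list (map h x) \<le> sum_list (map h y)"
    and "strictly_convex_on {0..} h \<Longrightarrow> sum_list (map h x) = sum_list (map h y) \<Longrightarrow> mset x = mset y"
proof -
  obtain c where c0: "\<And>x. 0 \<le> x \<Longrightarrow> 0 \<le> c x" and cmono: "\<And>x y. 0 \<le> x \<Longrightarrow> x \<le> y \<Longrightarrow> c x \<le> c y"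
    and sub: "\<And>x y. 0 \<le> x \<Longrightarrow> 0 \<le> y \<Longrightarrow> h x + c x * (y - x) \<le> h y"
    using monotone_subgradient[OF mono conv] by metis
  define d where "d = length x"
  define X where "X i = decr x ! i" for i
  define Y where "Y i = decr y ! i" for i
  have len: "length y = d" using maj by (simp add: submajorized_def d_def)
  have sx: "set (decr x) = set x" and sy: "set (decr y) = set y"
    by (simp_all add: decr_def)
  have X0: "0 \<le> X i" if "i < d" for i
    using x0 nth_mem[of i "decr x"] that by (auto simp: X_def d_def sx)
  have Y0: "0 \<le> Y i" if "i < d" for i
    using y0 nth_mem[of i "decr y"] that len by (auto simp: Y_def sy)
  have hx: "sum_list (map h x) = (\<Sum>i<d. h (X i))"
    using sum_list_map_mset_cong[of "decr x" x h]
    by (simp add: sum_list_sum_nth atLeast0LessThan X_def d_def)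
  have hy: "sum_list (map h y) = (\<Sum>i<d. h (Y i))"
    using sum_list_map_mset_cong[of "decr y" y h] len
    by (simp add: sum_list_sum_nth atLeast0LessThan Y_def)
  have part: "0 \<le> (\<Sum>i<k. Y i - X i)" if "k \<le> d" for k
  proof -
    have "sum_list (take k (decr x)) \<le> sum_list (take k (decr y))"
      using maj that unfolding submajorized_def by (cases "k = 0") (auto simp: d_def)
    then show ?thesis using that len
      by (simp add: sum_list_take_nth X_def Y_def d_def sum_subtractf)
  qed
  have abel: "0 \<le> (\<Sum>i<d. c (X i) * (Y i - X i))"
  proof (cases d)
    case (Suc e)
    have "X (Suc i) \<le> X i" if "i < e" for i
      using sorted_wrt_nth_less[OF sorted_wrt_decr[of x], of i "Suc i"] that Suc
      by (simp add: X_def d_def)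
    then have "c (X e) * (\<Sum>i<Suc e. Y i - X i) \<le> (\<Sum>i<Suc e. c (X i) * (Y i - X i))"
      using Suc X0 part by (intro summation_by_parts_ge[of e "\<lambda>i. c (X i)"]) (auto intro: cmono)
    moreover have "0 \<le> c (X e) * (\<Sum>i<Suc e. Y i - X i)"
      using c0[OF X0, of e] part[of "Suc e"] Suc by (intro mult_nonneg_nonneg) auto
    ultimately show ?thesis using Suc by simp
  qed simp
  have gap: "0 \<le> h (Y i) - h (X i) - c (X i) * (Y i - X i)" if "i < d" for i
    using sub[OF X0 Y0, OF that that] by simp
  have tot: "(\<Sum>i<d. h (Y i) - h (X i) - c (X i) * (Y i - X i))
      = sum_list (map h y) - sum_list (map h x) - (\<Sum>i<d. c (X i) * (Y i - X i))"
    by (simp add: hx hy sum_subtractf)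
  have tot0: "0 \<le> (\<Sum>i<d. h (Y i) - h (X i) - c (X i) * (Y i - X i))"
    using gap by (intro sum_nonneg) auto
  then show "sum_list (map h x) \<le> sum_list (map h y)" using tot abel by linarith
  assume strict: "strictly_convex_on {0..} h" and eq: "sum_list (map h x) = sum_list (map h y)"
  have "(\<Sum>i<d. h (Y i) - h (X i) - c (X i) * (Y i - X i)) = 0"
    using tot abel eq tot0 by linarith
  then have gap0: "h (Y i) - h (X i) - c (X i) * (Y i - X i) = 0" if "i < d" for i
    using gap that by (subst (asm) sum_nonneg_eq_0_iff) auto
  have "X i = Y i" if "i < d" for i
  proof (rule ccontr)
    assume ne: "X i \<noteq> Y i"
    define z where "z = 1/2 * X i + 1/2 * Y i"
    have "h z < 1/2 * h (X i) + 1/2 * h (Y i)"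
      using strict[unfolded strictly_convex_on_def, THEN conjunct2, rule_format, of "X i" "Y i" "1/2" "1/2"]
        ne X0[OF that] Y0[OF that] by (simp add: z_def)
    moreover have "h (X i) + c (X i) * (z - X i) \<le> h z"
      using X0[OF that] Y0[OF that] by (intro sub) (auto simp: z_def)
    moreover have "c (X i) * (z - X i) = 1/2 * (c (X i) * (Y i - X i))"
      by (simp add: z_def algebra_simps)
    ultimately show False using gap0[OF that] by linarith
  qed
  then have "decr x = decr y"
    using len by (intro nth_equalityI) (auto simp: X_def Y_def d_def)
  then show "mset x = mset y" by (simp add: decr_eq_iff)
qed

section \<open>Water-filling and the optimal spectrum\<close>

text \<open>
  The property that defines \<open>rho_vec\<close> as a unique object.
\<close>

definition optimal_spectrum :: "real \<Rightarrow> real \<Rightarrow> real list \<Rightarrow> int \<Rightarrow> real list \<Rightarrow> bool" where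
  "optimal_spectrum t \<eta> lam m \<rho> \<longleftrightarrow> \<rho> \<in> Lambda_set t \<eta> lam m \<and> sum_list \<rho> = t \<and>
     (\<forall>\<gamma>\<in>Lambda_set t \<eta> lam m. submajorized \<rho> \<gamma>) \<and> sorted (map2 (-) \<rho> lam)"

lemma rho_vec_eq_The: "rho_vec t \<eta> lam m = (THE \<rho>. optimal_spectrum t \<eta> lam m \<rho>)"
  by (simp add: rho_vec_def optimal_spectrum_def)

lemma Lambda_setI:
  assumes "length \<mu> = length lam" "\<gamma> = map2 (+) lam \<mu>" "\<And>i. i < length lam \<Longrightarrow> 0 \<le> \<mu> ! i \<and> \<mu> ! i \<le> \<eta>"
    and "t \<le> sum_list \<gamma>" "int (card {j. j < length lam \<and> \<mu> ! j \<noteq> 0}) \<le> int (length lam) - m"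
  shows "\<gamma> \<in> Lambda_set t \<eta> lam m"
proof -
  have "sum_list \<gamma> = sum_list lam + sum_list \<mu>"
    using assms(1,2) by (simp add: sum_list_sum_nth sum.distrib)
  then show ?thesis using assms unfolding Lambda_set_def by (auto intro!: exI[of _ \<mu>])
qed

lemma Lambda_setE:
  assumes "\<gamma> \<in> Lambda_set t \<eta> lam m"
  obtains \<mu> where "length \<mu> = length lam" "length \<gamma> = length lam" "\<gamma> = map2 (+) lam \<mu>"
    "\<And>i. i < length lam \<Longrightarrow> 0 \<le> \<mu> ! i \<and> \<mu> ! i \<le> \<eta>"
    "\<And>i. i < length lam \<Longrightarrow> \<gamma> ! i = lam ! i + \<mu> ! i" "t \<le> sum_list \<gamma>"
    "int (card {j. j < length lam \<and> \<mu> ! j \<noteq> 0}) \<le> int (length lam) - m"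
proof -
  obtain \<mu> where \<mu>: "length \<mu> = length lam" "\<gamma> = map2 (+) lam \<mu>" 
      "\<forall>i<length \<mu>. 0 \<le> \<mu> ! i \<and> \<mu> ! i \<le> \<eta>" "t - sum_list lam \<le> sum_list \<mu>"
      "int (card {j. j < length \<mu> \<and> \<mu> ! j \<noteq> 0}) \<le> int (length lam) - m"
    using assms unfolding Lambda_set_def by auto
  have "sum_list \<gamma> = sum_list lam + sum_list \<mu>"
    using \<mu>(1,2) by (simp add: sum_list_sum_nth sum.distrib)
  then show ?thesis using \<mu> by (intro that[of \<mu>]) auto
qed

lemma sum_if_ge: "(\<Sum>i<d. if k \<le> i then f i else 0) = sum f {k..<d}" for f :: "nat \<Rightarrow> real"
proof -
  have "{i \<in> {..<d}. k \<le> i} = {k..<d}" by auto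
  then show ?thesis using sum.inter_filter[of "{..<d}" f "\<lambda>i. k \<le> i"] by simp
qed

lemma sum_le_sum_top_segment:
  fixes \<phi> :: "nat \<Rightarrow> real"
  assumes mono: "\<And>i j. i \<le> j \<Longrightarrow> j < d \<Longrightarrow> \<phi> i \<le> \<phi> j" and nonneg: "\<And>i. i < d \<Longrightarrow> 0 \<le> \<phi> i"
    and J: "J \<subseteq> {..<d}" "card J \<le> d - k" and k: "k \<le> d"
  shows "sum \<phi> J \<le> sum \<phi> {k..<d}"
proof (cases "k = d")
  case True
  then have "J = {}" using J finite_subset[OF J(1)] by auto
  then show ?thesis using True by simp
next
  case False
  let ?L = "{k..<d}"
  have fin: "finite J" using J(1) finite_subset by blast
  have "sum \<phi> (J - ?L) \<le> real (card (J - ?L)) * \<phi> k"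
    using J(1) mono[of _ k] k False by (intro sum_bounded_above) auto
  also have "\<dots> \<le> real (card (?L - J)) * \<phi> k"
    using card_le_sym_Diff[of J ?L] fin J(2) nonneg[of k] k False
    by (intro mult_right_mono) auto
  also have "\<dots> \<le> sum \<phi> (?L - J)"
    using mono[of k] by (intro sum_bounded_below) auto
  finally have "sum \<phi> (J - ?L) \<le> sum \<phi> (?L - J)" .
  moreover have "sum \<phi> J = sum \<phi> (J \<inter> ?L) + sum \<phi> (J - ?L)"
    using fin by (simp add: sum.Int_Diff)
  moreover have "sum \<phi> ?L = sum \<phi> (J \<inter> ?L) + sum \<phi> (?L - J)"
    using sum.Int_Diff[of ?L \<phi> J] by (simp add: Int_commute)
  ultimately show ?thesis by simp
qed

text \<open>
  The increments that raise the entries from index \<open>k\<close> on towards the level \<open>c\<close>, none by more than \<open>\<eta>\<close>.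
\<close>

definition water_level_fill :: "real \<Rightarrow> real \<Rightarrow> nat \<Rightarrow> real list \<Rightarrow> real list" where
  "water_level_fill c \<eta> k lam =
     map (\<lambda>i. if i < k then 0 else min \<eta> (max 0 (c - lam ! i))) [0..<length lam]"

lemma hinge_sum_nth: "hinge_sum s xs = (\<Sum>i<length xs. max 0 (xs ! i - s))"
  by (simp add: hinge_sum_def sum_list_sum_nth atLeast0LessThan)

text \<open>
  Compare the hinge sums at \<open>s\<close>. If \<open>c \<le> s\<close>, then filling up to the level \<open>c\<close> has not changed the
  hinge sum of \<open>lam\<close>, which is below that of \<open>\<gamma>\<close>. If \<open>s < c\<close>, then \<open>max 0 (x - s) = x - s + max 0 (s - x)\<close>, and it
  remains to compare the deficits \<open>g x = max 0 (s - x)\<close>. Below \<open>s\<close> the filling has given the full increment \<open>\<eta>\<close> from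
  index \<open>k\<close> on, which lowers the deficit by \<open>\<phi> i\<close>. The competitor lowers it by at most \<open>\<phi> i\<close> at each
  index of its support, which is no larger, and \<open>\<phi>\<close> increases with \<open>i\<close> because \<open>g\<close> is convex and \<open>lam\<close>
  decreases.
\<close>

lemma water_level_fill_submajorized:
  assumes lam: "sorted_wrt (\<ge>) lam" and \<eta>: "0 < \<eta>" and k: "k \<le> length lam"
    and kd: "int (length lam) - m \<le> int (length lam - k) \<or> k = 0"
    and \<rho>: "\<rho> = map2 (+) lam (water_level_fill c \<eta> k lam)" and t: "sum_list \<rho> = t"
    and \<gamma>: "\<gamma> \<in> Lambda_set t \<eta> lam m"
  shows "submajorized \<rho> \<gamma>"
proof -
  define d where "d = length lam"
  obtain \<nu> where \<nu>: "length \<nu> = d" "length \<gamma> = d" "\<gamma> = map2 (+) lam \<nu>"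
    "\<And>i. i < d \<Longrightarrow> 0 \<le> \<nu> ! i \<and> \<nu> ! i \<le> \<eta>"
    "\<And>i. i < d \<Longrightarrow> \<gamma> ! i = lam ! i + \<nu> ! i" "t \<le> sum_list \<gamma>"
    "int (card {j. j < d \<and> \<nu> ! j \<noteq> 0}) \<le> int d - m"
    by (rule Lambda_setE[OF \<gamma>, folded d_def], rule that; blast)
  define J where "J = {j. j < d \<and> \<nu> ! j \<noteq> 0}"
  have J: "J \<subseteq> {..<d}" by (auto simp: J_def)
  have cJ: "card J \<le> d - k"
    using kd \<nu>(7) card_mono[OF finite_lessThan J] unfolding d_def J_def by (elim disjE) simp_all
  have len\<rho>: "length \<rho> = d" by (simp add: \<rho> water_level_fill_def d_def)
  have \<rho>i: "\<rho> ! i = lam ! i + (if i < k then 0 else min \<eta> (max 0 (c - lam ! i)))" if "i < d" for i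
    using that by (simp add: \<rho> water_level_fill_def d_def)
  have lam_anti: "lam ! j \<le> lam ! i" if "i \<le> j" "j < d" for i j
    using sorted_wrt_nth_less[OF lam, of i j] that by (cases "i = j") (auto simp: d_def)
  have "hinge_sum s \<rho> \<le> hinge_sum s \<gamma>" for s
  proof (cases "c \<le> s")
    case True
    have "max 0 (\<rho> ! i - s) \<le> max 0 (\<gamma> ! i - s)" if "i < d" for i
      using \<rho>i[OF that] \<nu>(4,5)[OF that] True \<eta> by auto
    then show ?thesis unfolding hinge_sum_nth len\<rho> \<nu>(2) by (intro sum_mono) auto
  next
    case False
    define g where "g x = max 0 (s - x)" for x
    define \<phi> where "\<phi> i = g (lam ! i) - g (lam ! i + \<eta>)" for i
    have split: "hinge_sum s xs = sum_list xs - real d * s + (\<Sum>i<d. g (xs ! i))" if "length xs = d" for xs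
    proof -
      have "hinge_sum s xs = (\<Sum>i<d. xs ! i - s + g (xs ! i))"
        unfolding hinge_sum_nth that g_def by (intro sum.cong) auto
      then show ?thesis using that 
        by (simp add: sum.distrib sum_subtractf sum_list_sum_nth atLeast0LessThan)
    qed
    have "(\<Sum>i<d. g (\<rho> ! i)) = (\<Sum>i<d. g (lam ! i) - (if k \<le> i then \<phi> i else 0))"
      using \<eta> False by (intro sum.cong) (auto simp: \<rho>i \<phi>_def g_def)
    also have "\<dots> = (\<Sum>i<d. g (lam ! i)) - (\<Sum>i<d. if k \<le> i then \<phi> i else 0)"
      by (simp add: sum_subtractf)
    also have "(\<Sum>i<d. if k \<le> i then \<phi> i else 0) = sum \<phi> {k..<d}"
      by (rule sum_if_ge)
    finally have G\<rho>: "(\<Sum>i<d. g (\<rho> ! i)) = (\<Sum>i<d. g (lam ! i)) - sum \<phi> {k..<d}" .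
    have "sum \<phi> J \<le> sum \<phi> {k..<d}"
    proof (rule sum_le_sum_top_segment[OF _ _ J cJ])
      show "\<phi> i \<le> \<phi> j" if "i \<le> j" "j < d" for i j
        using lam_anti[OF that] \<eta> by (auto simp: \<phi>_def g_def)
      show "0 \<le> \<phi> i" for i using \<eta> by (auto simp: \<phi>_def g_def)
    qed (use k d_def in simp)
    moreover have "(\<Sum>i<d. g (lam ! i) - (if i \<in> J then \<phi> i else 0)) \<le> (\<Sum>i<d. g (\<gamma> ! i))"
    proof (rule sum_mono)
      fix i assume "i \<in> {..<d}"
      then show "g (lam ! i) - (if i \<in> J then \<phi> i else 0) \<le> g (\<gamma> ! i)"
        using \<nu>(4,5)[of i] by (auto simp: J_def \<phi>_def g_def)
    qed
    moreover have "(\<Sum>i<d. g (lam ! i) - (if i \<in> J then \<phi> i else 0)) = (\<Sum>i<d. g (lam ! i)) - sum \<phi> J"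
      using J by (simp add: sum_subtractf sum.If_cases Int_absorb1)
    ultimately show ?thesis
      using split[OF len\<rho>] split[OF \<nu>(2)] G\<rho> t \<nu>(6) by linarith
  qed
  then show ?thesis using len\<rho> \<nu>(2) by (simp add: submajorized_iff_hinge_sum)
qed

text \<open>
  By the intermediate value theorem: the filled volume is \<open>0\<close> at the level of the smallest entry, and
  every increment is \<open>\<eta>\<close> at the level \<open>lam ! 0 + \<eta>\<close>.
\<close>

lemma water_level_exists:
  assumes lam: "sorted_wrt (\<ge>) lam" and \<eta>: "0 < \<eta>" and k: "k < length lam"
    and \<tau>: "0 \<le> \<tau>" "\<tau> \<le> real (length lam - k) * \<eta>"
  obtains c where "sum_list (water_level_fill c \<eta> k lam) = \<tau>"
proof -
  define d where "d = length lam"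
  define f where "f c = (\<Sum>i<d. if i < k then 0 else min \<eta> (max 0 (c - lam ! i)))" for c
  have lam_anti: "lam ! j \<le> lam ! i" if "i \<le> j" "j < d" for i j
    using sorted_wrt_nth_less[OF lam, of i j] that by (cases "i = j") (auto simp: d_def)
  have "f (lam ! (d - 1)) = 0"
    unfolding f_def using lam_anti[of _ "d - 1"] \<eta> by (intro sum.neutral) auto
  moreover have "f (lam ! 0 + \<eta>) = (\<Sum>i<d. if k \<le> i then \<eta> else 0)"
    unfolding f_def using \<eta> by (intro sum.cong) (use lam_anti[of 0] in \<open>fastforce simp: min_def max_def\<close>)+
  moreover have "(\<Sum>i<d. if k \<le> i then \<eta> else 0) = (\<Sum>i\<in>{k..<d}. \<eta>)"
    by (rule sum_if_ge)
  moreover have "continuous_on {lam ! (d - 1)..lam ! 0 + \<eta>} f"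
    unfolding f_def
  proof (rule continuous_on_sum)
    show "continuous_on {lam ! (d - 1)..lam ! 0 + \<eta>}
        (\<lambda>c. if i < k then 0 else min \<eta> (max 0 (c - lam ! i)))" for i
      by (cases "i < k") (auto intro!: continuous_intros)
  qed
  moreover have "lam ! (d - 1) \<le> lam ! 0 + \<eta>"
  proof -
    have "d - 1 < d" using k unfolding d_def by linarith
    then show ?thesis using lam_anti[of 0 "d - 1"] \<eta> by simp
  qed
  ultimately obtain c where "f c = \<tau>"
    using IVT'[of f "lam ! (d - 1)" \<tau> "lam ! 0 + \<eta>"] \<tau> by (auto simp: d_def)
  moreover have "sum_list (water_level_fill c \<eta> k lam) = (\<Sum>i<d. water_level_fill c \<eta> k lam ! i)"
    by (simp add: sum_list_sum_nth atLeast0LessThan d_def water_level_fill_def)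
  moreover have "\<dots> = f c"
    unfolding f_def by (intro sum.cong) (auto simp: water_level_fill_def d_def)
  ultimately show ?thesis by (intro that[of c]) simp
qed

text \<open>
  At most \<open>min (d - m) d\<close> entries may be raised. Since \<open>lam\<close> decreases, the last ones should be, which
  means filling from the index \<open>k = max 0 m\<close> on.
\<close>

lemma optimal_spectrum_exists:
  assumes lam: "sorted_wrt (\<ge>) lam" and \<eta>: "0 < \<eta>" and t: "sum_list lam < t"
    and t_le: "t - sum_list lam \<le> of_int (min (int (length lam) - m) (int (length lam))) * \<eta>"
  shows "\<exists>\<rho>. optimal_spectrum t \<eta> lam m \<rho>"
proof -
  let ?d = "length lam"
  define k where "k = nat (max 0 m)"
  have "0 < of_int (min (int ?d - m) (int ?d)) * \<eta>" using t t_le by linarith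
  then have "0 < min (int ?d - m) (int ?d)" using \<eta> by (simp add: zero_less_mult_iff)
  then have kd: "k < ?d" "min (int ?d - m) (int ?d) = int (?d - k)"
    by (cases "0 \<le> m"; simp add: k_def nat_less_iff)+
  have "0 \<le> t - sum_list lam" "t - sum_list lam \<le> real (?d - k) * \<eta>"
    using t t_le unfolding kd(2) of_int_of_nat_eq by linarith+
  then obtain c where c: "sum_list (water_level_fill c \<eta> k lam) = t - sum_list lam"
    using water_level_exists[OF lam \<eta> kd(1)] by blast
  define \<mu> where "\<mu> = water_level_fill c \<eta> k lam"
  define \<rho> where "\<rho> = map2 (+) lam \<mu>"
  have len: "length \<mu> = ?d" "length \<rho> = ?d" by (simp_all add: \<mu>_def \<rho>_def water_level_fill_def)
  have \<mu>i: "\<mu> ! i = (if i < k then 0 else min \<eta> (max 0 (c - lam ! i)))" if "i < ?d" for i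
    using that by (simp add: \<mu>_def water_level_fill_def)
  have sum: "sum_list \<rho> = t"
    using c len by (simp add: \<rho>_def \<mu>_def[symmetric] sum_list_sum_nth sum.distrib)
  have "{j. j < ?d \<and> \<mu> ! j \<noteq> 0} \<subseteq> {k..<?d}" using \<mu>i by (auto split: if_splits)
  then have "card {j. j < ?d \<and> \<mu> ! j \<noteq> 0} \<le> ?d - k"
    using card_mono[OF finite_atLeastLessThan] by (metis card_atLeastLessThan)
  then have mem: "\<rho> \<in> Lambda_set t \<eta> lam m"
    using len sum kd \<mu>i \<eta> by (intro Lambda_setI[of \<mu>]) (auto simp: \<rho>_def)
  have diff: "map2 (-) \<rho> lam = \<mu>"
    using len by (intro nth_equalityI) (auto simp: \<rho>_def)
  have lam_anti: "lam ! j \<le> lam ! i" if "i \<le> j" "j < ?d" for i j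
    using sorted_wrt_nth_less[OF lam, of i j] that by (cases "i = j") auto
  have "sorted \<mu>" unfolding sorted_iff_nth_mono
  proof (intro allI impI)
    fix i j assume "i \<le> j" "j < length \<mu>"
    then show "\<mu> ! i \<le> \<mu> ! j"
      using len \<mu>i[of i] \<mu>i[of j] lam_anti[of i j] \<eta> by (auto simp: min_def max_def)
  qed
  moreover have "submajorized \<rho> \<gamma>" if "\<gamma> \<in> Lambda_set t \<eta> lam m" for \<gamma>
    using kd by (intro water_level_fill_submajorized[OF lam \<eta> _ _ _ sum that, where k = k and c = c])
      (auto simp: k_def \<rho>_def \<mu>_def)
  ultimately show ?thesis using mem sum diff unfolding optimal_spectrum_def by metis
qed

text \<open>
  The midpoint of two optimal vectors is admissible. It has at least the sum of squares of either of them,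
  as both are submajorized by it, and strict convexity of the square then makes the two vectors equal.
\<close>

lemma optimal_spectrum_unique:
  assumes \<rho>: "optimal_spectrum t \<eta> lam m \<rho>" and \<sigma>: "optimal_spectrum t \<eta> lam m \<sigma>"
    and lam0: "\<And>x. x \<in> set lam \<Longrightarrow> 0 \<le> x"
  shows "\<rho> = \<sigma>"
proof -
  let ?d = "length lam"
  have mem1: "\<rho> \<in> Lambda_set t \<eta> lam m" using \<rho> by (simp add: optimal_spectrum_def)
  obtain \<mu> where \<mu>: "length \<mu> = ?d" "length \<rho> = ?d" "\<rho> = map2 (+) lam \<mu>"
    "\<And>i. i < ?d \<Longrightarrow> 0 \<le> \<mu> ! i \<and> \<mu> ! i \<le> \<eta>"
    "\<And>i. i < ?d \<Longrightarrow> \<rho> ! i = lam ! i + \<mu> ! i" "t \<le> sum_list \<rho>"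
    "int (card {j. j < ?d \<and> \<mu> ! j \<noteq> 0}) \<le> int ?d - m"
    by (rule Lambda_setE[OF mem1], rule that; blast)
  have mem2: "\<sigma> \<in> Lambda_set t \<eta> lam m" using \<sigma> by (simp add: optimal_spectrum_def)
  obtain \<nu> where \<nu>: "length \<nu> = ?d" "length \<sigma> = ?d" "\<sigma> = map2 (+) lam \<nu>"
    "\<And>i. i < ?d \<Longrightarrow> 0 \<le> \<nu> ! i \<and> \<nu> ! i \<le> \<eta>"
    "\<And>i. i < ?d \<Longrightarrow> \<sigma> ! i = lam ! i + \<nu> ! i" "t \<le> sum_list \<sigma>"
    "int (card {j. j < ?d \<and> \<nu> ! j \<noteq> 0}) \<le> int ?d - m"
    by (rule Lambda_setE[OF mem2], rule that; blast)
  have sums: "sum_list \<rho> = t" "sum_list \<sigma> = t"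
    using \<rho> \<sigma> by (auto simp: optimal_spectrum_def)
  have "map2 (-) \<rho> lam = \<mu>" "map2 (-) \<sigma> lam = \<nu>"
    using \<mu>(1,2,5) \<nu>(1,2,5) by (auto intro!: nth_equalityI)
  then have sorted: "sorted \<mu>" "sorted \<nu>" using \<rho> \<sigma> by (auto simp: optimal_spectrum_def)
  define \<kappa> where "\<kappa> = map (\<lambda>i. (\<mu> ! i + \<nu> ! i) / 2) [0..<?d]"
  define \<gamma> where "\<gamma> = map2 (+) lam \<kappa>"
  have \<kappa>: "length \<kappa> = ?d" "\<And>i. i < ?d \<Longrightarrow> \<kappa> ! i = (\<mu> ! i + \<nu> ! i) / 2"
    by (simp_all add: \<kappa>_def)
  have \<gamma>i: "\<gamma> ! i = (\<rho> ! i + \<sigma> ! i) / 2" if "i < ?d" for i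
    using that \<kappa> \<mu>(5) \<nu>(5) by (simp add: \<gamma>_def field_simps)
  have len\<gamma>: "length \<gamma> = ?d" by (simp add: \<gamma>_def \<kappa>)
  let ?supp = "\<lambda>x :: real list. {j. j < ?d \<and> x ! j \<noteq> 0}"
  \<comment> \<open>Both supports are final segments of the index range, so one contains the other and the
    midpoint is still admissible.\<close>
  have seg: "j \<in> ?supp x" if "sorted x" "length x = ?d" "\<And>i. i < ?d \<Longrightarrow> 0 \<le> x ! i" "i \<in> ?supp x"
    "i \<le> j" "j < ?d" for i j x
    using that sorted_nth_mono[OF that(1), of i j] by fastforce
  have seg\<mu>: "j \<in> ?supp \<mu>" if "i \<in> ?supp \<mu>" "i \<le> j" "j < ?d" for i j
    using seg[OF sorted(1) \<mu>(1) _ that] \<mu>(4) by blast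
  have seg\<nu>: "j \<in> ?supp \<nu>" if "i \<in> ?supp \<nu>" "i \<le> j" "j < ?d" for i j
    using seg[OF sorted(2) \<nu>(1) _ that] \<nu>(4) by blast
  have "?supp \<mu> \<subseteq> ?supp \<nu> \<or> ?supp \<nu> \<subseteq> ?supp \<mu>"
  proof (rule disjCI, rule subsetI)
    fix j assume "\<not> ?supp \<nu> \<subseteq> ?supp \<mu>" and j: "j \<in> ?supp \<mu>"
    then obtain i where i: "i \<in> ?supp \<nu>" "i \<notin> ?supp \<mu>" by blast
    then have "i \<le> j" using seg\<mu>[OF j, of i] by (cases "i \<le> j") auto
    then show "j \<in> ?supp \<nu>" using seg\<nu>[OF i(1)] j by blast
  qed
  moreover have "?supp \<kappa> \<subseteq> ?supp \<mu> \<union> ?supp \<nu>"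
  proof (rule subsetI)
    fix j assume "j \<in> ?supp \<kappa>"
    then show "j \<in> ?supp \<mu> \<union> ?supp \<nu>" using \<kappa>(2)[of j] by auto
  qed
  ultimately have "?supp \<kappa> \<subseteq> ?supp \<mu> \<or> ?supp \<kappa> \<subseteq> ?supp \<nu>" by blast
  then have "card (?supp \<kappa>) \<le> card (?supp \<mu>) \<or> card (?supp \<kappa>) \<le> card (?supp \<nu>)"
    by (auto intro!: card_mono)
  then have card: "int (card (?supp \<kappa>)) \<le> int ?d - m" using \<mu>(7) \<nu>(7) by linarith
  have "sum_list \<gamma> = t"
    using sums \<mu>(2) \<nu>(2) len\<gamma> by (simp add: sum_list_sum_nth \<gamma>i sum_divide_distrib[symmetric] sum.distrib)
  moreover have "0 \<le> \<kappa> ! i \<and> \<kappa> ! i \<le> \<eta>" if "i < ?d" for i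
    using \<kappa>(2)[OF that] \<mu>(4)[OF that] \<nu>(4)[OF that] by auto
  ultimately have mem: "\<gamma> \<in> Lambda_set t \<eta> lam m"
    using \<kappa>(1) card by (intro Lambda_setI[of \<kappa>]) (simp_all add: \<gamma>_def)
  have sq: "mono_on {0..} (\<lambda>x::real. x\<^sup>2)" "convex_on {0..} (\<lambda>x::real. x\<^sup>2)"
    by (auto intro!: mono_onI power_mono convex_on_subset[OF convex_power2])
  have nonneg: "0 \<le> \<rho> ! i" "0 \<le> \<sigma> ! i" "0 \<le> \<gamma> ! i" if "i < ?d" for i
    using lam0[OF nth_mem[OF that]] \<mu>(4,5)[OF that] \<nu>(4,5)[OF that] \<gamma>i[OF that] by auto
  have le: "(\<Sum>i<?d. (x ! i)\<^sup>2) \<le> (\<Sum>i<?d. (\<gamma> ! i)\<^sup>2)" 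
    if "submajorized x \<gamma>" "length x = ?d" "\<And>i. i < ?d \<Longrightarrow> 0 \<le> x ! i" for x
  proof -
    have "sum_list (map (\<lambda>x. x\<^sup>2) x) \<le> sum_list (map (\<lambda>x. x\<^sup>2) \<gamma>)"
      using that(2,3) nonneg len\<gamma> by (intro sum_le_if_submajorized(1)[OF that(1) sq]) (auto simp: in_set_conv_nth)
    then show ?thesis using that(2) len\<gamma> by (simp add: sum_list_sum_nth atLeast0LessThan)
  qed
  have "(\<Sum>i<?d. (\<rho> ! i - \<sigma> ! i)\<^sup>2) = 2 * (\<Sum>i<?d. (\<rho> ! i)\<^sup>2) + 2 * (\<Sum>i<?d. (\<sigma> ! i)\<^sup>2) - 4 * (\<Sum>i<?d. (\<gamma> ! i)\<^sup>2)"
  proof -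
    have "(\<Sum>i<?d. (\<rho> ! i - \<sigma> ! i)\<^sup>2)
        = (\<Sum>i<?d. 2 * (\<rho> ! i)\<^sup>2 + 2 * (\<sigma> ! i)\<^sup>2 - 4 * (\<gamma> ! i)\<^sup>2)"
      by (intro sum.cong) (auto simp: \<gamma>i power2_eq_square field_simps)
    then show ?thesis by (simp add: sum.distrib sum_subtractf sum_distrib_left)
  qed
  then have "(\<Sum>i<?d. (\<rho> ! i - \<sigma> ! i)\<^sup>2) \<le> 0"
    using le[of \<rho>] le[of \<sigma>] \<mu>(2) \<nu>(2) nonneg mem \<rho> \<sigma> by (simp add: optimal_spectrum_def)
  then have "(\<Sum>i<?d. (\<rho> ! i - \<sigma> ! i)\<^sup>2) = 0" by (intro antisym sum_nonneg) auto
  then have "\<forall>i<?d. \<rho> ! i = \<sigma> ! i" by (subst (asm) sum_nonneg_eq_0_iff) auto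
  then show ?thesis using \<mu>(2) \<nu>(2) by (intro nth_equalityI) auto
qed

lemma optimal_spectrum_rho_vec:
  assumes "sorted_wrt (\<ge>) lam" "0 < \<eta>" "sum_list lam < t"
    and "t - sum_list lam \<le> of_int (min (int (length lam) - m) (int (length lam))) * \<eta>"
    and "\<And>x. x \<in> set lam \<Longrightarrow> 0 \<le> x"
  shows "optimal_spectrum t \<eta> lam m (rho_vec t \<eta> lam m)"
proof -
  have "\<exists>!\<rho>. optimal_spectrum t \<eta> lam m \<rho>"
    using optimal_spectrum_exists[OF assms(1-4)] optimal_spectrum_unique assms(5) by blast
  then show ?thesis unfolding rho_vec_eq_The by (rule theI')
qed

section \<open>Doubly stochastic matrices\<close>

lemma summation_by_parts_nonneg:
  fixes c z :: "nat \<Rightarrow> real"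
  assumes "\<And>i j. i \<le> j \<Longrightarrow> j < d \<Longrightarrow> c j \<le> c i" "\<And>k. k \<le> d \<Longrightarrow> 0 \<le> (\<Sum>i<k. z i)" "(\<Sum>i<d. z i) = 0"
  shows "0 \<le> (\<Sum>i<d. c i * z i)"
proof (cases d)
  case (Suc e)
  have "c e * (\<Sum>i<Suc e. z i) \<le> (\<Sum>i<Suc e. c i * z i)"
    by (rule summation_by_parts_ge) (simp_all add: assms(1,2) Suc)
  then show ?thesis using assms(3) unfolding Suc by simp
qed simp

text \<open>
  The averages \<open>\<Sum>\<^sub>j W i j * b j\<close> are majorized by \<open>b\<close>: the first \<open>k\<close> of them add up to a combination of the
  \<open>b j\<close> with weights \<open>s j\<close> in \<open>[0, 1]\<close> of total weight \<open>k\<close>, which is at least the sum of the \<open>k\<close> smallest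
  \<open>b j\<close>. Abel summation against the decreasing \<open>a\<close> finishes the proof.
\<close>

lemma doubly_stochastic_sum_ge:
  fixes W :: "nat \<Rightarrow> nat \<Rightarrow> real"
  assumes W0: "\<And>i j. i < d \<Longrightarrow> j < d \<Longrightarrow> 0 \<le> W i j"
    and rows: "\<And>i. i < d \<Longrightarrow> (\<Sum>j<d. W i j) = 1" and cols: "\<And>j. j < d \<Longrightarrow> (\<Sum>i<d. W i j) = 1"
    and a: "\<And>i j. i \<le> j \<Longrightarrow> j < d \<Longrightarrow> a j \<le> a i" and b: "\<And>i j. i \<le> j \<Longrightarrow> j < d \<Longrightarrow> b i \<le> b j"
  shows "(\<Sum>i<d. a i * b i) \<le> (\<Sum>i<d. \<Sum>j<d. a i * b j * W i j)"
proof -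
  define z where "z i = (\<Sum>j<d. b j * W i j) - b i" for i
  have total: "(\<Sum>i<d. z i) = 0"
  proof -
    have "(\<Sum>i<d. \<Sum>j<d. b j * W i j) = (\<Sum>j<d. b j * (\<Sum>i<d. W i j))"
      by (subst sum.swap) (simp add: sum_distrib_left)
    then show ?thesis using cols by (simp add: z_def sum_subtractf)
  qed
  have part: "0 \<le> (\<Sum>i<k. z i)" if "k \<le> d" for k
  proof (cases "k = d")
    case True
    then show ?thesis using total by simp
  next
    case False
    then have kd: "k < d" using that by simp
    define s where "s j = (\<Sum>i<k. W i j)" for j
    have s0: "0 \<le> s j" "s j \<le> 1" if "j < d" for j
    proof -
      show "0 \<le> s j" unfolding s_def using kd that by (intro sum_nonneg W0) auto
      have "s j \<le> (\<Sum>i<d. W i j)" unfolding s_def using kd that by (intro sum_mono2 W0) auto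
      then show "s j \<le> 1" using cols that by simp
    qed
    have "(\<Sum>j<d. s j) = (\<Sum>i<k. \<Sum>j<d. W i j)" unfolding s_def by (rule sum.swap)
    also have "\<dots> = real k" using rows kd by simp
    finally have stot: "(\<Sum>j<d. s j) = real k" .
    have ind: "(\<Sum>j<d. (if j < k then x j else 0)) = (\<Sum>j<k. x j)" for x :: "nat \<Rightarrow> real"
      using kd by (subst sum.inter_filter[symmetric]) (auto intro!: sum.cong)
    have "0 \<le> (\<Sum>j<d. (b j - b k) * (s j - (if j < k then 1 else 0)))"
    proof (intro sum_nonneg)
      fix j assume "j \<in> {..<d}"
      then show "0 \<le> (b j - b k) * (s j - (if j < k then 1 else 0))"
        using b[of j k] b[of k j] s0[of j] kd by (auto intro: mult_nonneg_nonneg mult_nonpos_nonpos)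
    qed
    also have "\<dots> = (\<Sum>j<d. b j * s j - (if j < k then b j else 0) - b k * s j + (if j < k then b k else 0))"
      by (intro sum.cong) (auto simp: algebra_simps)
    also have "\<dots> = (\<Sum>j<d. b j * s j) - (\<Sum>j<k. b j)"
      using stot by (simp add: sum.distrib sum_subtractf ind flip: sum_distrib_left)
    also have "(\<Sum>j<d. b j * s j) = (\<Sum>i<k. \<Sum>j<d. b j * W i j)"
      unfolding s_def sum_distrib_left by (rule sum.swap)
    finally show ?thesis by (simp add: z_def sum_subtractf)
  qed
  have "0 \<le> (\<Sum>i<d. a i * z i)"
    using total part a by (intro summation_by_parts_nonneg) auto
  also have "\<dots> = (\<Sum>i<d. \<Sum>j<d. a i * b j * W i j) - (\<Sum>i<d. a i * b i)"
    by (simp add: z_def right_diff_distrib sum_distrib_left sum_subtractf mult_ac)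
  finally show ?thesis by simp
qed

text \<open>
  If the lower bound is attained, then mass sits in increasing position only. Otherwise a little mass moved
  from \<open>(p, q)\<close> and \<open>(r, s)\<close> to \<open>(p, s)\<close> and \<open>(r, q)\<close> would leave the matrix doubly stochastic and
  make the sum smaller.
\<close>

lemma doubly_stochastic_support:
  fixes W :: "nat \<Rightarrow> nat \<Rightarrow> real"
  assumes W0: "\<And>i j. i < d \<Longrightarrow> j < d \<Longrightarrow> 0 \<le> W i j"
    and rows: "\<And>i. i < d \<Longrightarrow> (\<Sum>j<d. W i j) = 1" and cols: "\<And>j. j < d \<Longrightarrow> (\<Sum>i<d. W i j) = 1"
    and a: "\<And>i j. i \<le> j \<Longrightarrow> j < d \<Longrightarrow> a j \<le> a i" and b: "\<And>i j. i \<le> j \<Longrightarrow> j < d \<Longrightarrow> b i \<le> b j"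
    and eq: "(\<Sum>i<d. \<Sum>j<d. a i * b j * W i j) = (\<Sum>i<d. a i * b i)"
    and ij: "p < d" "q < d" "r < d" "s < d" "0 < W p q" "0 < W r s" "a r < a p"
  shows "b q \<le> b s"
proof (rule ccontr)
  assume "\<not> b q \<le> b s"
  then have bs: "b s < b q" by simp
  \<comment> \<open>The largest amount that can be moved without making an entry negative.\<close>
  define \<delta> where "\<delta> = min (W p q) (W r s)"
  have \<delta>: "0 < \<delta>" "\<delta> \<le> W p q" "\<delta> \<le> W r s" using ij by (auto simp: \<delta>_def)
  \<comment> \<open>The move adds the product of two vectors of sum zero, so row and column sums stay the same.\<close>
  define R where "R i = (if i = p then 1 else 0) - (if i = r then 1 else 0 :: real)" for i
  define C where "C j = (if j = s then 1 else 0) - (if j = q then 1 else 0 :: real)" for j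
  define V where "V i j = W i j + \<delta> * (R i * C j)" for i j
  have delta: "(\<Sum>i<d. f i * (if i = l then 1 else 0)) = f l" if "l < d" for l and f :: "nat \<Rightarrow> real"
    using that by (simp add: if_distrib[of "(*) _"] cong: if_cong)
  have R0: "(\<Sum>i<d. R i) = 0" "(\<Sum>i<d. a i * R i) = a p - a r"
    using ij by (simp_all add: R_def sum_subtractf right_diff_distrib delta)
  have C0: "(\<Sum>i<d. C i) = 0" "(\<Sum>i<d. b i * C i) = b s - b q"
    using ij by (simp_all add: C_def sum_subtractf right_diff_distrib delta)
  have pr: "p \<noteq> r" "q \<noteq> s" using ij bs by auto
  have "(\<Sum>i<d. a i * b i) \<le> (\<Sum>i<d. \<Sum>j<d. a i * b j * V i j)"
  proof (rule doubly_stochastic_sum_ge)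
    show "0 \<le> V i j" if "i < d" "j < d" for i j
      using W0[OF that] \<delta> pr by (auto simp: V_def R_def C_def)
    show "(\<Sum>j<d. V i j) = 1" if "i < d" for i
      using rows[OF that] C0 by (simp add: V_def sum.distrib flip: sum_distrib_left)
    show "(\<Sum>i<d. V i j) = 1" if "j < d" for j
      using cols[OF that] R0 by (simp add: V_def sum.distrib flip: sum_distrib_left sum_distrib_right)
  qed (use a b in auto)
  also have "\<dots> = (\<Sum>i<d. \<Sum>j<d. a i * b j * W i j) + \<delta> * ((\<Sum>i<d. a i * R i) * (\<Sum>j<d. b j * C j))"
    by (simp add: V_def sum_product sum_distrib_left sum.distrib algebra_simps)
  finally have "0 \<le> \<delta> * ((a p - a r) * (b s - b q))" using eq R0 C0 by simp
  moreover have "\<delta> * ((a p - a r) * (b s - b q)) < 0"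
    using \<delta> ij bs by (intro mult_pos_neg) auto
  ultimately show False by simp
qed

section \<open>Hermitian matrices and orthonormal eigenbases\<close>

lemma cinner_add_left: "cinner (x + y) z = cinner x z + cinner y z"
  by (simp add: cinner_def algebra_simps sum.distrib)

lemma cinner_add_right: "cinner x (y + z) = cinner x y + cinner x z"
  by (simp add: cinner_def algebra_simps sum.distrib)

lemma cinner_diff_left: "cinner (x - y) z = cinner x z - cinner y z"
  by (simp add: cinner_def algebra_simps sum_subtractf)

lemma cinner_scale_left: "cinner (c *s x) y = c * cinner x y"
  by (simp add: cinner_def sum_distrib_left mult_ac)

lemma cinner_scale_right: "cinner x (c *s y) = cnj c * cinner x y"
  by (simp add: cinner_def sum_distrib_left mult_ac)

lemma cinner_zero [simp]: "cinner 0 x = 0" "cinner x 0 = 0"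
  by (simp_all add: cinner_def)

lemma cinner_sum_left: "cinner (\<Sum>i\<in>I. f i) y = (\<Sum>i\<in>I. cinner (f i) y)"
  by (induction I rule: infinite_finite_induct) (simp_all add: cinner_add_left)

lemma cinner_sum_right: "cinner y (\<Sum>i\<in>I. f i) = (\<Sum>i\<in>I. cinner y (f i))"
  by (induction I rule: infinite_finite_induct) (simp_all add: cinner_add_right)

lemma cinner_commute: "cinner x y = cnj (cinner y x)"
  by (simp add: cinner_def mult.commute)

lemma cinner_eq_0_commute: "cinner x y = 0 \<longleftrightarrow> cinner y x = 0"
  by (metis cinner_commute complex_cnj_zero)

lemma Re_cinner: "Re (cinner x y) = inner x y"
  by (simp add: cinner_def inner_vec_def inner_complex_def)

lemma cinner_self: "cinner x x = of_real ((norm x)\<^sup>2)"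
proof (rule complex_eqI)
  show "Re (cinner x x) = Re (of_real ((norm x)\<^sup>2))"
    by (simp add: Re_cinner power2_norm_eq_inner)
  have "cnj (cinner x x) = cinner x x" by (metis cinner_commute)
  then show "Im (cinner x x) = Im (of_real ((norm x)\<^sup>2))"
    by (simp add: complex_eq_iff)
qed

lemma cinner_self_eq_0 [simp]: "cinner x x = 0 \<longleftrightarrow> x = 0"
  by (simp add: cinner_self)

definition hermitian :: "complex^'d^'d \<Rightarrow> bool" where
  "hermitian A \<longleftrightarrow> cadjoint A = A"

lemma hermitian_cinner: "hermitian A \<Longrightarrow> cinner (A *v x) y = cinner x (A *v y)"
  by (simp add: hermitian_def cinner_cadjoint)

text \<open>
  Orthonormality of the first \<open>k\<close> vectors only, which allows eigenbases to be built one vector at a time.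
\<close>

definition orthonormal_upto :: "nat \<Rightarrow> (nat \<Rightarrow> complex^'d) \<Rightarrow> bool" where
  "orthonormal_upto k v \<longleftrightarrow> (\<forall>i<k. \<forall>j<k. cinner (v i) (v j) = (if i = j then 1 else 0))"

lemma orthogonal_family_card_le:
  fixes f :: "'a \<Rightarrow> complex^'d"
  assumes fin: "finite I" and nz: "\<And>i. i \<in> I \<Longrightarrow> f i \<noteq> 0"
    and orth: "\<And>i j. i \<in> I \<Longrightarrow> j \<in> I \<Longrightarrow> i \<noteq> j \<Longrightarrow> cinner (f i) (f j) = 0"
  shows "card I \<le> CARD('d)"
proof -
  have inj: "inj_on f I"
    by (rule inj_onI) (metis nz orth cinner_self_eq_0)
  have "vec.independent (f ` I)"
  proof
    assume "vec.dependent (f ` I)"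
    then obtain u where u: "\<exists>v\<in>f ` I. u v \<noteq> 0" "(\<Sum>v\<in>f ` I. u v *s v) = 0"
      unfolding vec.dependent_finite[OF finite_imageI[OF fin]] by blast
    then obtain i where i: "i \<in> I" "u (f i) \<noteq> 0" by auto
    have "0 = cinner (\<Sum>j\<in>I. u (f j) *s f j) (f i)"
      using u(2) inj by (simp add: sum.reindex)
    also have "\<dots> = (\<Sum>j\<in>I. u (f j) * cinner (f j) (f i))"
      by (simp add: cinner_sum_left cinner_scale_left)
    also have "\<dots> = (\<Sum>j\<in>{i}. u (f j) * cinner (f j) (f i))"
      using fin i orth by (intro sum.mono_neutral_right) auto
    finally show False using i nz by simp
  qed
  then have "card (f ` I) \<le> vec.dim (UNIV :: (complex^'d) set)"
    by (intro vec.independent_card_le_dim) auto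
  then show ?thesis unfolding vec_dim_card card_image[OF inj] .
qed

text \<open>
  Orthogonality to \<open>y\<close> over the complex numbers is real orthogonality to \<open>y\<close> and to \<open>\<i> y\<close>. These are
  fewer than \<open>2 d\<close> real conditions.
\<close>

lemma exists_orthogonal_vector:
  fixes S :: "(complex^'d) set"
  assumes "finite S" "card S < CARD('d)"
  obtains x where "norm x = 1" "\<And>y. y \<in> S \<Longrightarrow> cinner x y = 0"
proof -
  let ?T = "S \<union> (\<lambda>y. \<i> *s y) ` S"
  have "card ?T \<le> card S + card S"
    by (meson assms(1) card_Un_le card_image_le add_left_mono order_trans)
  then have "dim ?T < DIM(complex^'d)"
    using dim_le_card'[of ?T] assms by simp
  then obtain x :: "complex^'d" where x: "x \<noteq> 0" "\<And>y. y \<in> span ?T \<Longrightarrow> orthogonal x y"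
    using orthogonal_to_subspace_exists by blast
  have orth: "cinner x y = 0" if "y \<in> S" for y
  proof (rule complex_eqI)
    show "Re (cinner x y) = Re 0"
      using x(2)[of y] that by (simp add: span_base orthogonal_def Re_cinner)
    have "Re (cinner x (\<i> *s y)) = 0"
      using x(2)[of "\<i> *s y"] that by (simp add: span_base orthogonal_def Re_cinner)
    then show "Im (cinner x y) = Im 0" by (simp add: cinner_scale_right)
  qed
  let ?x = "of_real (1 / norm x) *s x"
  have "cinner ?x ?x = 1"
    unfolding cinner_scale_left cinner_scale_right cinner_self[of x]
    using x(1) by (simp add: power2_eq_square)
  then have "(norm ?x)\<^sup>2 = 1" unfolding cinner_self of_real_eq_1_iff .
  then have "norm ?x = 1" using power2_eq_imp_eq[of "norm ?x" 1] by simp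
  moreover have "cinner ?x y = 0" if "y \<in> S" for y using orth[OF that] by (simp add: cinner_scale_left)
  ultimately show ?thesis using that by blast
qed

lemma orthonormal_expansion:
  fixes v :: "nat \<Rightarrow> complex^'d"
  assumes v: "orthonormal_upto CARD('d) v"
  shows "x = (\<Sum>j<CARD('d). cinner x (v j) *s v j)"
proof (rule ccontr)
  let ?d = "CARD('d)"
  define z where "z = x - (\<Sum>j<?d. cinner x (v j) *s v j)"
  assume "x \<noteq> (\<Sum>j<?d. cinner x (v j) *s v j)"
  then have z0: "z \<noteq> 0" by (simp add: z_def)
  have vv: "cinner (v i) (v j) = (if i = j then 1 else 0)" if "i < ?d" "j < ?d" for i j
    using v that by (simp add: orthonormal_upto_def)
  have zo: "cinner z (v i) = 0" if "i < ?d" for i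
  proof -
    have "(\<Sum>j<?d. cinner x (v j) * cinner (v j) (v i)) = (\<Sum>j<?d. if j = i then cinner x (v j) else 0)"
      using that by (intro sum.cong) (auto simp: vv)
    then show ?thesis
      using that by (simp add: z_def cinner_diff_left cinner_sum_left cinner_scale_left)
  qed
  define f where "f = v(?d := z)"
  have "card {..?d} \<le> ?d"
  proof (rule orthogonal_family_card_le[of _ f])
    show "f i \<noteq> 0" if "i \<in> {..?d}" for i
      using that z0 vv[of i i] by (auto simp: f_def)
    show "cinner (f i) (f j) = 0" if "i \<in> {..?d}" "j \<in> {..?d}" "i \<noteq> j" for i j
      using that zo vv cinner_eq_0_commute[of z] by (auto simp: f_def)
  qed auto
  then show False by simp
qed

lemma orthonormal_basis_iff: "orthonormal_basis v \<longleftrightarrow> orthonormal_upto CARD('d) (v :: nat \<Rightarrow> complex^'d)"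
proof
  assume v: "orthonormal_upto CARD('d) v"
  have "x \<in> vec.span (v ` {..<CARD('d)})" for x
  proof -
    have "(\<Sum>j<CARD('d). cinner x (v j) *s v j) \<in> vec.span (v ` {..<CARD('d)})"
      by (intro vec.span_sum vec.span_scale vec.span_base) auto
    then show ?thesis unfolding orthonormal_expansion[OF v, symmetric] .
  qed
  then have "vec.span (v ` {..<CARD('d)}) = UNIV" by blast
  with v show "orthonormal_basis v" unfolding orthonormal_basis_def orthonormal_upto_def by (rule conjI)
qed (simp add: orthonormal_basis_def orthonormal_upto_def)

lemma orthonormal_basis_cinner:
  "orthonormal_basis (v :: nat \<Rightarrow> complex^'d) \<Longrightarrow> i < CARD('d) \<Longrightarrow> j < CARD('d) \<Longrightarrow>
    cinner (v i) (v j) = (if i = j then 1 else 0)"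
  by (simp add: orthonormal_basis_def)

lemma orthonormal_basis_norm:
  fixes v :: "nat \<Rightarrow> complex^'d"
  assumes "orthonormal_basis v" "j < CARD('d)"
  shows "norm (v j) = 1"
proof -
  have "(norm (v j))\<^sup>2 = 1"
    using orthonormal_basis_cinner[OF assms(1) assms(2) assms(2)] unfolding cinner_self
    by (metis of_real_eq_1_iff)
  then show ?thesis using power2_eq_imp_eq[of "norm (v j)" 1] by simp
qed

lemma basis_expansion:
  "orthonormal_basis (v :: nat \<Rightarrow> complex^'d) \<Longrightarrow> x = (\<Sum>j<CARD('d). cinner x (v j) *s v j)"
  by (simp add: orthonormal_basis_iff orthonormal_expansion)

lemma parseval_cinner:
  assumes "orthonormal_basis (v :: nat \<Rightarrow> complex^'d)"
  shows "cinner x y = (\<Sum>j<CARD('d). cinner x (v j) * cinner (v j) y)"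
proof -
  have "cinner x y = cinner (\<Sum>j<CARD('d). cinner x (v j) *s v j) y"
    by (simp only: basis_expansion[OF assms, symmetric])
  then show ?thesis by (simp add: cinner_sum_left cinner_scale_left)
qed

lemma parseval:
  assumes "orthonormal_basis (v :: nat \<Rightarrow> complex^'d)"
  shows "(norm x)\<^sup>2 = (\<Sum>j<CARD('d). (cmod (cinner x (v j)))\<^sup>2)"
proof -
  have "of_real ((norm x)\<^sup>2) = (\<Sum>j<CARD('d). cinner x (v j) * cnj (cinner x (v j)))"
    using parseval_cinner[OF assms, of x x] by (simp add: cinner_self cinner_commute[of "v _" x])
  also have "\<dots> = of_real (\<Sum>j<CARD('d). (cmod (cinner x (v j)))\<^sup>2)"
    by (simp add: complex_norm_square[symmetric])
  finally show ?thesis using of_real_eq_iff by blast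
qed

lemma matrix_eq_on_basis:
  fixes A B :: "complex^'d^'n"
  assumes v: "orthonormal_basis v" and eq: "\<And>i. i < CARD('d) \<Longrightarrow> A *v v i = B *v v i"
  shows "A = B"
proof -
  have "A *v x = B *v x" for x
  proof -
    have "A *v (\<Sum>j<CARD('d). cinner x (v j) *s v j) = B *v (\<Sum>j<CARD('d). cinner x (v j) *s v j)"
      by (simp add: vec.sum vec.scale eq)
    then show ?thesis unfolding basis_expansion[OF v, symmetric] .
  qed
  then show ?thesis by (simp add: matrix_eq)
qed

lemma scaleR_complex_vector: "r *\<^sub>R x = complex_of_real r *s x" for x :: "complex^'d"
  by (simp add: vec_eq_iff complex_eq_iff)

text \<open>
  A maximizer \<open>x\<close> of the Rayleigh quotient on the unit sphere of \<open>V\<close> is an eigenvector: moving it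
  against the residual \<open>z = \<alpha> x - A x\<close> would otherwise increase the quotient to first order.
\<close>

lemma hermitian_eigenvector_exists:
  fixes A :: "complex^'d^'d"
  assumes A: "hermitian A" and V: "vec.subspace V" and inv: "\<And>x. x \<in> V \<Longrightarrow> A *v x \<in> V"
    and nz: "\<exists>x\<in>V. x \<noteq> 0"
  obtains x \<alpha> where "x \<in> V" "norm x = 1" "A *v x = complex_of_real \<alpha> *s x"
proof -
  note scaleR = scaleR_complex_vector
  have sub: "subspace V"
    using V unfolding subspace_def vec.subspace_def scaleR by blast
  define S where "S = sphere 0 1 \<inter> V"
  have "compact S" unfolding S_def using closed_subspace[OF sub] by (intro compact_Int_closed) auto
  moreover have "S \<noteq> {}"
  proof -
    obtain x where x: "x \<in> V" "x \<noteq> 0" using nz by blast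
    then have "(1 / norm x) *\<^sub>R x \<in> S" using subspace_scale[OF sub] by (auto simp: S_def)
    then show ?thesis by blast
  qed
  moreover have "continuous_on S (\<lambda>x. inner (A *v x) x)"
    by (intro continuous_intros linear_continuous_on matrix_vector_mul_bounded_linear) 
  ultimately obtain x where x: "x \<in> S" and max: "\<And>y. y \<in> S \<Longrightarrow> inner (A *v y) y \<le> inner (A *v x) x"
    using continuous_attains_sup[of S] by blast
  define \<alpha> where "\<alpha> = inner (A *v x) x"
  have xV: "x \<in> V" and nx: "norm x = 1" using x by (auto simp: S_def)
  have bound: "inner (A *v y) y \<le> \<alpha> * (norm y)\<^sup>2" if "y \<in> V" for y
  proof (cases "y = 0")
    case False
    have "(1 / norm y) *\<^sub>R y \<in> S" using that subspace_scale[OF sub] False by (auto simp: S_def)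
    then have "inner (A *v ((1 / norm y) *\<^sub>R y)) ((1 / norm y) *\<^sub>R y) \<le> \<alpha>" unfolding \<alpha>_def by (rule max)
    moreover have "A *v ((1 / norm y) *\<^sub>R y) = (1 / norm y) *\<^sub>R (A *v y)"
      by (simp add: scaleR vec.scale)
    ultimately have "inner (A *v y) y / (norm y)\<^sup>2 \<le> \<alpha>" by (simp add: power2_eq_square)
    then show ?thesis using False by (simp add: pos_divide_le_eq)
  qed simp
  define z where "z = \<alpha> *\<^sub>R x - A *v x"
  have zV: "z \<in> V" unfolding z_def using xV inv subspace_diff[OF sub] subspace_scale[OF sub] by blast
  have sym: "inner (A *v u) w = inner u (A *v w)" for u w
    using hermitian_cinner[OF A, of u w] by (simp flip: Re_cinner)
  define q where "q = \<alpha> * (norm z)\<^sup>2 - inner (A *v z) z"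
  have quad: "2 * s * (norm z)\<^sup>2 \<le> s\<^sup>2 * q" for s
  proof -
    have "x - s *\<^sub>R z \<in> V" using xV zV subspace_diff[OF sub] subspace_scale[OF sub] by blast
    then have le: "inner (A *v (x - s *\<^sub>R z)) (x - s *\<^sub>R z) \<le> \<alpha> * (norm (x - s *\<^sub>R z))\<^sup>2" by (rule bound)
    have 1: "A *v (x - s *\<^sub>R z) = A *v x - s *\<^sub>R (A *v z)"
      by (simp add: scaleR vec.scale vec.diff)
    have 2: "inner (A *v x - s *\<^sub>R (A *v z)) (x - s *\<^sub>R z) = \<alpha> - 2 * s * inner (A *v x) z + s\<^sup>2 * inner (A *v z) z"
      using sym[of z x] by (simp add: inner_diff_left inner_diff_right \<alpha>_def inner_commute power2_eq_square algebra_simps)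
    have 3: "(norm (x - s *\<^sub>R z))\<^sup>2 = 1 - 2 * s * inner x z + s\<^sup>2 * (norm z)\<^sup>2"
      using nx unfolding power2_norm_eq_inner norm_eq_1
      by (simp add: inner_diff_left inner_diff_right inner_commute power2_eq_square algebra_simps)
    have 4: "(norm z)\<^sup>2 = \<alpha> * inner x z - inner (A *v x) z"
      by (simp add: power2_norm_eq_inner z_def inner_diff_left inner_diff_right algebra_simps)
    have "\<alpha> - 2 * s * inner (A *v x) z + s\<^sup>2 * inner (A *v z) z \<le> \<alpha> * (1 - 2 * s * inner x z + s\<^sup>2 * (norm z)\<^sup>2)"
      using le unfolding 1 2 3 .
    then have "2 * s * (\<alpha> * inner x z - inner (A *v x) z) \<le> s\<^sup>2 * (\<alpha> * (norm z)\<^sup>2 - inner (A *v z) z)"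
      by (simp add: algebra_simps)
    then show ?thesis unfolding q_def 4[symmetric] .
  qed
  have "(norm z)\<^sup>2 = 0"
  proof (rule ccontr)
    assume "(norm z)\<^sup>2 \<noteq> 0"
    then have n: "0 < (norm z)\<^sup>2" by simp
    \<comment> \<open>So small that the quadratic term \<open>s\<^sup>2 q\<close> cannot outweigh the linear one; the summand \<open>1\<close> covers
      \<open>q = 0\<close>.\<close>
    define s where "s = (norm z)\<^sup>2 / (\<bar>q\<bar> + 1)"
    have s: "0 < s" using n by (simp add: s_def)
    have "s * (2 * (norm z)\<^sup>2) \<le> s * (s * q)" using quad[of s] by (simp add: power2_eq_square mult_ac)
    then have "2 * (norm z)\<^sup>2 \<le> s * q" using s by simp
    also have "\<dots> \<le> s * (\<bar>q\<bar> + 1)" using s by (intro mult_left_mono) auto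
    also have "\<dots> = (norm z)\<^sup>2" by (simp add: s_def)
    finally show False using n by simp
  qed
  then have "A *v x = complex_of_real \<alpha> *s x" by (simp add: z_def scaleR)
  then show ?thesis using that xV nx by blast
qed

text \<open>
  The orthogonal complement of the eigenvectors found so far is invariant under both matrices. In it \<open>A\<close>
  has an eigenvector, the eigenspace is invariant under \<open>B\<close> because the matrices commute, and
  so it contains an eigenvector of \<open>B\<close>.
\<close>

theorem commuting_hermitian_common_basis:
  fixes A B :: "complex^'d^'d"
  assumes A: "hermitian A" and B: "hermitian B" and AB: "A ** B = B ** A"
  obtains v \<alpha> \<beta> where "orthonormal_basis v"
    "\<And>i. i < CARD('d) \<Longrightarrow> A *v v i = complex_of_real (\<alpha> i) *s v i"
    "\<And>i. i < CARD('d) \<Longrightarrow> B *v v i = complex_of_real (\<beta> i) *s v i"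
proof -
  have "\<exists>v \<alpha> \<beta>. orthonormal_upto k v \<and> (\<forall>i<k. A *v v i = complex_of_real (\<alpha> i) *s v i \<and>
      B *v v i = complex_of_real (\<beta> i) *s v i)" if "k \<le> CARD('d)" for k
    using that
  proof (induction k)
    case 0
    show ?case by (simp add: orthonormal_upto_def)
  next
    case (Suc k)
    then obtain v \<alpha> \<beta> where v: "orthonormal_upto k v"
      and av: "\<And>i. i < k \<Longrightarrow> A *v v i = complex_of_real (\<alpha> i) *s v i"
      and bv: "\<And>i. i < k \<Longrightarrow> B *v v i = complex_of_real (\<beta> i) *s v i" by auto
    define V where "V = {x. \<forall>i<k. cinner x (v i) = 0}"
    have subV: "vec.subspace V"
      by (rule vec.subspaceI) (auto simp: V_def cinner_add_left cinner_scale_left)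
    have AV: "A *v x \<in> V" if "x \<in> V" for x
      using that by (auto simp: V_def hermitian_cinner[OF A] av cinner_scale_right)
    have BV: "B *v x \<in> V" if "x \<in> V" for x
      using that by (auto simp: V_def hermitian_cinner[OF B] bv cinner_scale_right)
    have "card (v ` {..<k}) < CARD('d)"
      using Suc.prems card_image_le[of "{..<k}" v] by simp
    then obtain x0 :: "complex^'d" where "norm x0 = 1" "\<And>y. y \<in> v ` {..<k} \<Longrightarrow> cinner x0 y = 0"
      using exists_orthogonal_vector[of "v ` {..<k}"] by blast
    then have "\<exists>x\<in>V. x \<noteq> 0" by (intro bexI[of _ x0]) (auto simp: V_def)
    then obtain x1 a where x1: "x1 \<in> V" "norm x1 = 1" "A *v x1 = complex_of_real a *s x1"
      using hermitian_eigenvector_exists[OF A subV AV] by blast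
    define E where "E = {x\<in>V. A *v x = complex_of_real a *s x}"
    have subE: "vec.subspace E"
      using subV unfolding E_def
      by (auto intro!: vec.subspaceI simp: vec.add vec.scale vec.subspace_0 vec.subspace_add vec.subspace_scale
          vec.scale_right_distrib mult.commute)
    have BE: "B *v x \<in> E" if "x \<in> E" for x
    proof -
      have "A *v (B *v x) = B *v (A *v x)" by (simp add: matrix_vector_mul_assoc AB)
      then show ?thesis using that BV by (simp add: E_def vec.scale)
    qed
    have "\<exists>x\<in>E. x \<noteq> 0" using x1 by (intro bexI[of _ x1]) (auto simp: E_def)
    then obtain x b where x: "x \<in> E" "norm x = 1" "B *v x = complex_of_real b *s x"
      using hermitian_eigenvector_exists[OF B subE BE] by blast
    have xv: "cinner x (v i) = 0" "cinner (v i) x = 0" if "i < k" for i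
      using x(1) that cinner_eq_0_commute by (auto simp: E_def V_def)
    have "orthonormal_upto (Suc k) (v(k := x))"
      using v x(2) xv by (auto simp: orthonormal_upto_def less_Suc_eq cinner_self)
    moreover have "A *v (v(k := x)) i = complex_of_real ((\<alpha>(k := a)) i) *s (v(k := x)) i \<and>
        B *v (v(k := x)) i = complex_of_real ((\<beta>(k := b)) i) *s (v(k := x)) i" if "i < Suc k" for i
      using that x av bv by (auto simp: E_def less_Suc_eq)
    ultimately show ?case by blast
  qed
  then show ?thesis using that unfolding orthonormal_basis_iff by blast
qed

section \<open>Spectral sums and eigenvalue lists\<close>

definition spectral_sum :: "(nat \<Rightarrow> complex^'d) \<Rightarrow> (nat \<Rightarrow> real) \<Rightarrow> complex^'d^'d" where
  "spectral_sum v a = (\<Sum>j<CARD('d). a j *\<^sub>R tensor (v j) (v j))"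

lemma matrix_sum_mult: "(\<Sum>j\<in>I. M j) *v x = (\<Sum>j\<in>I. M j *v x)" for M :: "'a \<Rightarrow> complex^'m^'n"
  by (induction I rule: infinite_finite_induct) (simp_all add: matrix_vector_mult_add_rdistrib)

lemma scaleR_matrix_mult: "(r *\<^sub>R M) *v x = complex_of_real r *s (M *v x)" for M :: "complex^'m^'n"
  by (simp add: vec_eq_iff matrix_vector_mult_def sum_distrib_left mult_ac scaleR_conv_of_real[where 'a = complex])

lemma spectral_sum_mult:
  "spectral_sum v a *v x = (\<Sum>j<CARD('d). (of_real (a j) * cinner x (v j)) *s v j)" for x :: "complex^'d"
  by (simp add: spectral_sum_def matrix_sum_mult scaleR_matrix_mult tensor_mult)

lemma spectral_sum_eigenvector:
  fixes v :: "nat \<Rightarrow> complex^'d"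
  assumes "orthonormal_basis v" "i < CARD('d)"
  shows "spectral_sum v a *v v i = complex_of_real (a i) *s v i"
proof -
  have "spectral_sum v a *v v i = (\<Sum>j<CARD('d). if j = i then complex_of_real (a i) *s v i else 0)"
    unfolding spectral_sum_mult
    using assms by (intro sum.cong) (auto simp: orthonormal_basis_cinner)
  then show ?thesis using assms(2) by simp
qed

lemma eq_spectral_sum_iff:
  fixes v :: "nat \<Rightarrow> complex^'d"
  assumes "orthonormal_basis v"
  shows "A = spectral_sum v a \<longleftrightarrow> (\<forall>i<CARD('d). A *v v i = complex_of_real (a i) *s v i)"
  using assms by (auto simp: spectral_sum_eigenvector intro: matrix_eq_on_basis)

lemma spectral_sum_cong: "(\<And>j. j < CARD('d) \<Longrightarrow> a j = b j) \<Longrightarrow> spectral_sum v a = spectral_sum v b"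
  for v :: "nat \<Rightarrow> complex^'d"
  by (simp add: spectral_sum_def)

lemma cadjoint_add: "cadjoint (A + B) = cadjoint A + cadjoint B"
  by (simp add: cadjoint_def vec_eq_iff)

lemma cadjoint_sum: "cadjoint (\<Sum>j\<in>I. M j) = (\<Sum>j\<in>I. cadjoint (M j))"
  by (simp add: cadjoint_def vec_eq_iff)

lemma hermitian_spectral_sum: "hermitian (spectral_sum v a)"
  unfolding hermitian_def spectral_sum_def cadjoint_sum
  by (intro sum.cong) (auto simp: cadjoint_def tensor_def vec_eq_iff mult.commute)

lemma spectral_sum_add: "spectral_sum v (\<lambda>j. a j + b j) = spectral_sum v a + spectral_sum v b"
  by (simp add: spectral_sum_def sum.distrib scaleR_left_distrib)

lemma spectral_sum_matrix_mult:
  assumes "orthonormal_basis v"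
  shows "spectral_sum v a ** spectral_sum v b = spectral_sum v (\<lambda>j. a j * b j)"
  using assms by (subst eq_spectral_sum_iff)
    (auto simp: spectral_sum_eigenvector vec.scale mult_ac simp flip: matrix_vector_mul_assoc)

lemma inner_spectral_sum:
  "inner (spectral_sum v a *v x) x = (\<Sum>j<CARD('d). a j * (cmod (cinner x (v j)))\<^sup>2)" for x :: "complex^'d"
proof -
  have "cinner (spectral_sum v a *v x) x = (\<Sum>j<CARD('d). of_real (a j) * (cinner x (v j) * cnj (cinner x (v j))))"
    unfolding spectral_sum_mult cinner_sum_left cinner_scale_left
    by (intro sum.cong refl) (metis cinner_commute mult.assoc)
  also have "\<dots> = of_real (\<Sum>j<CARD('d). a j * (cmod (cinner x (v j)))\<^sup>2)"
    by (simp flip: complex_norm_square)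
  finally show ?thesis by (metis Re_cinner Re_complex_of_real)
qed

lemma trace_sum: "trace (\<Sum>j\<in>I. M j) = (\<Sum>j\<in>I. trace (M j))" for M :: "'a \<Rightarrow> complex^'n^'n"
  by (induction I rule: infinite_finite_induct) (simp_all add: trace_add trace_0[unfolded mat_0])

lemma trace_tensor: "trace (tensor x y) = cinner x y"
  by (simp add: trace_def tensor_def cinner_def)

lemma trace_scaleR: "trace (r *\<^sub>R M) = complex_of_real r * trace M" for M :: "complex^'n^'n"
  by (simp add: trace_def sum_distrib_left scaleR_conv_of_real[where 'a = complex])

lemma trace_spectral_sum:
  fixes v :: "nat \<Rightarrow> complex^'d"
  assumes "orthonormal_basis v"
  shows "trace (spectral_sum v a) = of_real (\<Sum>j<CARD('d). a j)"
  using assms by (simp add: spectral_sum_def trace_sum trace_scaleR trace_tensor orthonormal_basis_cinner)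

lemma sum_const_poly: "(\<Sum>k\<in>I. [:f k:]) = [:\<Sum>k\<in>I. f k:]"
  by (induction I rule: infinite_finite_induct) simp_all

text \<open>
  The matrix \<open>U\<close> of the basis vectors diagonalizes \<open>X - A\<close> over the ring of polynomials, \<open>(X - A) U = U D\<close>,
  and \<open>det U\<close> is a nonzero constant.
\<close>

lemma charpoly_spectral_sum:
  fixes v :: "nat \<Rightarrow> complex^'d"
  assumes v: "orthonormal_basis v"
  shows "charpoly (spectral_sum v a) = (\<Prod>j<CARD('d). [:- complex_of_real (a j), 1:])"
proof -
  define A where "A = spectral_sum v a"
  \<comment> \<open>Matrices are indexed by the type \<open>'d\<close>, bases by numbers.\<close>
  obtain \<pi> :: "'d \<Rightarrow> nat" where \<pi>: "bij_betw \<pi> UNIV {..<CARD('d)}"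
    using finite_same_card_bij[of "UNIV :: 'd set" "{..<CARD('d)}"] by auto
  have \<pi>d: "\<pi> i < CARD('d)" for i using \<pi> by (auto simp: bij_betw_def)
  have \<pi>inj: "\<pi> i = \<pi> j \<longleftrightarrow> i = j" for i j using \<pi> by (auto simp: bij_betw_def inj_on_def)
  define M :: "complex poly^'d^'d" where "M = (\<chi> i j. (if i = j then [:0, 1:] else 0) - [:A $ i $ j:])"
  define U :: "complex poly^'d^'d" where "U = (\<chi> i j. [:v (\<pi> j) $ i:])"
  define U' :: "complex poly^'d^'d" where "U' = (\<chi> i j. [:cnj (v (\<pi> i) $ j):])"
  define D :: "complex poly^'d^'d" where "D = (\<chi> i j. if i = j then [:- complex_of_real (a (\<pi> i)), 1:] else 0)"
  have MU: "M ** U = U ** D"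
  proof -
    have "(M ** U) $ i $ j = (U ** D) $ i $ j" for i j
    proof -
      have "(A *v v (\<pi> j)) $ i = complex_of_real (a (\<pi> j)) * v (\<pi> j) $ i"
        using spectral_sum_eigenvector[OF v \<pi>d, of a j] by (simp add: A_def)
      then have ev: "(\<Sum>k\<in>UNIV. A $ i $ k * v (\<pi> j) $ k) = complex_of_real (a (\<pi> j)) * v (\<pi> j) $ i"
        by (simp add: matrix_vector_mult_def)
      have "(M ** U) $ i $ j = (\<Sum>k\<in>UNIV. (if i = k then [:0, v (\<pi> j) $ k:] else 0) - [:A $ i $ k * v (\<pi> j) $ k:])"
        unfolding matrix_matrix_mult_def M_def U_def
        by (simp add: algebra_simps, intro sum.cong) (auto simp: algebra_simps)
      also have "\<dots> = [:0, v (\<pi> j) $ i:] - [:complex_of_real (a (\<pi> j)) * v (\<pi> j) $ i:]"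
        by (simp add: sum_subtractf sum_const_poly ev)
      also have "\<dots> = [:v (\<pi> j) $ i:] * [:- complex_of_real (a (\<pi> j)), 1:]" by simp
      also have "\<dots> = (\<Sum>k\<in>UNIV. if k = j then [:v (\<pi> j) $ i:] * [:- complex_of_real (a (\<pi> j)), 1:] else 0)"
        by simp
      also have "\<dots> = (\<Sum>k\<in>UNIV. U $ i $ k * D $ k $ j)"
        by (intro sum.cong) (auto simp: U_def D_def)
      also have "\<dots> = (U ** D) $ i $ j" by (simp add: matrix_matrix_mult_def)
      finally show ?thesis .
    qed
    then show ?thesis by (simp add: vec_eq_iff)
  qed
  have "U' ** U = mat 1"
  proof -
    have "(U' ** U) $ i $ j = (mat 1 :: complex poly^'d^'d) $ i $ j" for i j
    proof -
      have "(U' ** U) $ i $ j = (\<Sum>k\<in>UNIV. [:v (\<pi> j) $ k * cnj (v (\<pi> i) $ k):])"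
        unfolding matrix_matrix_mult_def U'_def U_def by (simp add: mult.commute)
      also have "\<dots> = [:cinner (v (\<pi> j)) (v (\<pi> i)):]"
        unfolding cinner_def by (rule sum_const_poly)
      finally show ?thesis using orthonormal_basis_cinner[OF v \<pi>d \<pi>d] \<pi>inj by (simp add: mat_def one_pCons)
    qed
    then show ?thesis by (simp add: vec_eq_iff)
  qed
  then have "det U' * det U = 1" by (metis det_mul det_I)
  then have U0: "det U \<noteq> 0" by auto
  have "det M * det U = det D * det U" using MU det_mul by (metis mult.commute)
  then have "det M = det D" using U0 by simp
  also have "det D = (\<Prod>i\<in>UNIV. [:- complex_of_real (a (\<pi> i)), 1:])"
    by (subst det_diagonal) (simp_all add: D_def)
  also have "\<dots> = (\<Prod>j<CARD('d). [:- complex_of_real (a j), 1:])"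
    by (rule prod.reindex_bij_betw[OF \<pi>])
  finally show ?thesis by (simp add: charpoly_def M_def A_def)
qed

lemma eigvals_spectral_sum:
  fixes v :: "nat \<Rightarrow> complex^'d"
  assumes v: "orthonormal_basis v"
  shows "eigvals (spectral_sum v a) = decr (map a [0..<CARD('d)])"
proof -
  have "proots (charpoly (spectral_sum v a)) = (\<Sum>j<CARD('d). {#complex_of_real (a j)#})"
    unfolding charpoly_spectral_sum[OF v] by (subst proots_prod) simp_all
  also have "image_mset Re (\<Sum>j<n. {#complex_of_real (a j)#}) = mset (map a [0..<n])" for n
    by (induction n) simp_all
  finally show ?thesis by (simp only: eigvals_def decr_def sorted_list_of_multiset_mset)
qed

lemma sorting_permutation:
  fixes \<kappa> :: "nat \<Rightarrow> real"
  obtains p where "bij_betw p {..<d} {..<d}" "\<And>i j. i \<le> j \<Longrightarrow> j < d \<Longrightarrow> \<kappa> (p i) \<le> \<kappa> (p j)"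
proof
  define L where "L = sort_key \<kappa> [0..<d]"
  have L: "length L = d" "distinct L" "set L = {..<d}" by (auto simp: L_def)
  show "bij_betw ((!) L) {..<d} {..<d}" using bij_betw_nth[OF L(2)] L by auto
  fix i j assume "i \<le> j" "j < d"
  then show "\<kappa> (L ! i) \<le> \<kappa> (L ! j)"
    using sorted_nth_mono[of "map \<kappa> L" i j] L(1) by (simp add: L_def)
qed

lemma spectral_sum_permute:
  fixes v :: "nat \<Rightarrow> complex^'d"
  assumes p: "bij_betw p {..<CARD('d)} {..<CARD('d)}" and v: "orthonormal_basis v"
  shows "orthonormal_basis (v \<circ> p)" "spectral_sum (v \<circ> p) (a \<circ> p) = spectral_sum v a"
proof -
  have pd: "p i < CARD('d)" if "i < CARD('d)" for i using p that by (auto simp: bij_betw_def)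
  have pinj: "p i = p j \<longleftrightarrow> i = j" if "i < CARD('d)" "j < CARD('d)" for i j
    using p that by (auto simp: bij_betw_def inj_on_def)
  show "orthonormal_basis (v \<circ> p)"
    unfolding orthonormal_basis_iff orthonormal_upto_def
    using pd pinj orthonormal_basis_cinner[OF v] by simp
  show "spectral_sum (v \<circ> p) (a \<circ> p) = spectral_sum v a"
    unfolding spectral_sum_def comp_def
    by (rule sum.reindex_bij_betw[OF p, of "\<lambda>j. a j *\<^sub>R tensor (v j) (v j)"])
qed

text \<open>
  The case \<open>B = A\<close> of the common eigenbasis, with the basis vectors put into the order of \<open>eigvals\<close>.
\<close>

theorem spectral_decomposition:
  fixes A :: "complex^'d^'d"
  assumes A: "hermitian A"
  obtains v where "orthonormal_basis v" "A = spectral_sum v (\<lambda>j. eigvals A ! j)"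
proof -
  obtain w \<alpha> where w: "orthonormal_basis w" "\<And>i. i < CARD('d) \<Longrightarrow> A *v w i = complex_of_real (\<alpha> i) *s w i"
    using commuting_hermitian_common_basis[OF A A refl] by metis
  have Aw: "A = spectral_sum w \<alpha>" using w by (simp add: eq_spectral_sum_iff)
  obtain p where p: "bij_betw p {..<CARD('d)} {..<CARD('d)}"
      "\<And>i j. i \<le> j \<Longrightarrow> j < CARD('d) \<Longrightarrow> - \<alpha> (p i) \<le> - \<alpha> (p j)"
    using sorting_permutation[of "CARD('d)" "\<lambda>i. - \<alpha> i"] by metis
  have v: "orthonormal_basis (w \<circ> p)" "A = spectral_sum (w \<circ> p) (\<alpha> \<circ> p)"
    using spectral_sum_permute[OF p(1) w(1)] Aw by auto
  have "eigvals A = decr (map (\<alpha> \<circ> p) [0..<CARD('d)])"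
    using eigvals_spectral_sum[OF v(1)] v(2) by metis
  also have "\<dots> = map (\<alpha> \<circ> p) [0..<CARD('d)]"
    using p(2) by (intro decr_ident) (auto simp: sorted_wrt_iff_nth_less)
  finally have "eigvals A ! j = (\<alpha> \<circ> p) j" if "j < CARD('d)" for j using that by simp
  then have "A = spectral_sum (w \<circ> p) (\<lambda>j. eigvals A ! j)"
    using v(2) spectral_sum_cong by metis
  then show ?thesis using that v(1) by blast
qed

lemma length_eigvals: "hermitian A \<Longrightarrow> length (eigvals A) = CARD('d)" for A :: "complex^'d^'d"
  by (metis eigvals_spectral_sum length_decr length_map length_upt minus_nat.diff_0 spectral_decomposition)

lemma sorted_eigvals: "sorted_wrt (\<ge>) (eigvals A)"
  by (simp add: eigvals_def sorted_wrt_rev)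

lemma eigvals_antimono:
  fixes A :: "complex^'d^'d"
  shows "hermitian A \<Longrightarrow> i \<le> j \<Longrightarrow> j < CARD('d) \<Longrightarrow> eigvals A ! j \<le> eigvals A ! i"
  using sorted_wrt_nth_less[OF sorted_eigvals[of A], of i j] length_eigvals[of A] by (cases "i = j") auto

section \<open>Lidskii's inequality and its equality case\<close>

lemma hermitian_add: "hermitian A \<Longrightarrow> hermitian B \<Longrightarrow> hermitian (A + B)"
  by (simp add: hermitian_def cadjoint_add)

lemma sum_eigvals:
  fixes A :: "complex^'d^'d"
  assumes "hermitian A"
  shows "(\<Sum>i<CARD('d). eigvals A ! i) = Re (trace A)"
proof -
  obtain v where v: "orthonormal_basis v" "A = spectral_sum v (\<lambda>j. eigvals A ! j)"
    using spectral_decomposition[OF assms] .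
  then have "trace A = of_real (\<Sum>j<CARD('d). eigvals A ! j)" by (metis trace_spectral_sum)
  then show ?thesis by simp
qed

lemma sum_eigvals_sq:
  fixes A :: "complex^'d^'d"
  assumes "hermitian A"
  shows "(\<Sum>i<CARD('d). (eigvals A ! i)\<^sup>2) = Re (trace (A ** A))"
proof -
  obtain v where v: "orthonormal_basis v" "A = spectral_sum v (\<lambda>j. eigvals A ! j)"
    using spectral_decomposition[OF assms] .
  then have "A ** A = spectral_sum v (\<lambda>j. eigvals A ! j * eigvals A ! j)" by (metis spectral_sum_matrix_mult)
  then have "trace (A ** A) = of_real (\<Sum>j<CARD('d). eigvals A ! j * eigvals A ! j)"
    using v(1) by (simp add: trace_spectral_sum)
  then show ?thesis by (simp add: power2_eq_square)
qed

lemma inner_of_decomposition: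
  fixes A :: "complex^'d^'d"
  assumes "orthonormal_basis v" "A = spectral_sum v a"
  shows "inner (A *v x) x = (\<Sum>j<CARD('d). a j * (cmod (cinner x (v j)))\<^sup>2)"
  unfolding assms(2) by (rule inner_spectral_sum)

text \<open>
  Weyl's monotonicity, with indices counted from \<open>0\<close>. The first \<open>i\<close> eigenvectors of \<open>M\<close> and the last \<open>d - i - 1\<close> of \<open>A\<close> are fewer than \<open>d\<close>
  vectors, so some unit vector \<open>x\<close> is orthogonal to all of them. Its quadratic form is at least the
  \<open>i\<close>-th eigenvalue for \<open>A\<close> and at most the \<open>i\<close>-th eigenvalue for \<open>M\<close>.
\<close>

lemma eigvals_mono:
  fixes A M :: "complex^'d^'d"
  assumes A: "hermitian A" and M: "hermitian M" and le: "\<And>x. inner (A *v x) x \<le> inner (M *v x) x"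
    and i: "i < CARD('d)"
  shows "eigvals A ! i \<le> eigvals M ! i"
proof -
  let ?d = "CARD('d)"
  obtain u where u: "orthonormal_basis u" "A = spectral_sum u (\<lambda>j. eigvals A ! j)"
    using spectral_decomposition[OF A] .
  obtain w where w: "orthonormal_basis w" "M = spectral_sum w (\<lambda>j. eigvals M ! j)"
    using spectral_decomposition[OF M] .
  let ?S = "w ` {..<i} \<union> u ` {Suc i..<?d}"
  have "card ?S \<le> card (w ` {..<i}) + card (u ` {Suc i..<?d})" by (rule card_Un_le)
  also have "\<dots> \<le> i + (?d - Suc i)"
    using card_image_le[of "{..<i}" w] card_image_le[of "{Suc i..<?d}" u] by simp
  also have "\<dots> < ?d" using i by simp
  finally obtain x :: "complex^'d" where x: "norm x = 1" "\<And>y. y \<in> ?S \<Longrightarrow> cinner x y = 0"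
    using exists_orthogonal_vector[of ?S] by blast
  have "eigvals A ! i = (\<Sum>j<?d. eigvals A ! i * (cmod (cinner x (u j)))\<^sup>2)"
    using parseval[OF u(1), of x] x(1) by (simp flip: sum_distrib_left)
  also have "\<dots> \<le> (\<Sum>j<?d. eigvals A ! j * (cmod (cinner x (u j)))\<^sup>2)"
  proof (rule sum_mono)
    fix j assume j: "j \<in> {..<?d}"
    show "eigvals A ! i * (cmod (cinner x (u j)))\<^sup>2 \<le> eigvals A ! j * (cmod (cinner x (u j)))\<^sup>2"
    proof (cases "j \<le> i")
      case True
      then show ?thesis using eigvals_antimono[OF A True i] by (intro mult_right_mono) auto
    next
      case False
      then have "cinner x (u j) = 0" using j by (intro x(2)) auto
      then show ?thesis by simp
    qed
  qed
  also have "\<dots> = inner (A *v x) x" by (rule inner_of_decomposition[OF u, symmetric])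
  also have "\<dots> \<le> inner (M *v x) x" by (rule le)
  also have "\<dots> = (\<Sum>j<?d. eigvals M ! j * (cmod (cinner x (w j)))\<^sup>2)" by (rule inner_of_decomposition[OF w])
  also have "\<dots> \<le> (\<Sum>j<?d. eigvals M ! i * (cmod (cinner x (w j)))\<^sup>2)"
  proof (rule sum_mono)
    fix j assume j: "j \<in> {..<?d}"
    show "eigvals M ! j * (cmod (cinner x (w j)))\<^sup>2 \<le> eigvals M ! i * (cmod (cinner x (w j)))\<^sup>2"
    proof (cases "i \<le> j")
      case True
      then show ?thesis using eigvals_antimono[OF M True] j by (intro mult_right_mono) auto
    next
      case False
      then have "cinner x (w j) = 0" using j by (intro x(2)) auto
      then show ?thesis by simp
    qed
  qed
  also have "\<dots> = eigvals M ! i"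
    using parseval[OF w(1), of x] x(1) by (simp flip: sum_distrib_left)
  finally show ?thesis .
qed

text \<open>
  The largest eigenvalue of \<open>A\<close> is paired with the smallest one of \<open>B\<close>, and so on. In Lidskii's inequality
  this is the extremal way to add the two spectra.
\<close>

definition opposed_sum :: "complex^'d^'d \<Rightarrow> complex^'d^'d \<Rightarrow> real list" where
  "opposed_sum A B = map2 (+) (eigvals A) (rev (eigvals B))"

lemma opposed_sum_nth:
  fixes A B :: "complex^'d^'d"
  assumes "hermitian A" "hermitian B"
  shows "length (opposed_sum A B) = CARD('d)"
    and "i < CARD('d) \<Longrightarrow> opposed_sum A B ! i = eigvals A ! i + eigvals B ! (CARD('d) - 1 - i)"
  using assms by (simp_all add: opposed_sum_def length_eigvals rev_nth)

lemma reversal_bij: "bij_betw (\<lambda>i. d - 1 - i) {..<d} {..<d::nat}"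
  by (rule bij_betw_byWitness[where f' = "\<lambda>i. d - 1 - i"]) auto

lemma reversed_spectral_decomposition:
  fixes B :: "complex^'d^'d"
  assumes "hermitian B"
  obtains v where "orthonormal_basis v" "B = spectral_sum v (\<lambda>j. eigvals B ! (CARD('d) - 1 - j))"
proof -
  obtain v where v: "orthonormal_basis v" "B = spectral_sum v (\<lambda>j. eigvals B ! j)"
    using spectral_decomposition[OF assms] .
  show ?thesis
    using that[of "v \<circ> (\<lambda>i. CARD('d) - 1 - i)"] spectral_sum_permute(1)[OF reversal_bij v(1)]
      spectral_sum_permute(2)[OF reversal_bij v(1), of "\<lambda>j. eigvals B ! j"] v(2)
    by (simp add: comp_def)
qed

text \<open>
  Fix \<open>s\<close> and let \<open>P\<close> be the positive part of \<open>A + B - s\<close> and \<open>D = s - B\<close>. Then \<open>A \<le> D + P\<close> and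
  \<open>D \<le> D + P\<close>, so the \<open>i\<close>-th eigenvalue of \<open>D + P\<close> is at least that of \<open>A\<close> and that of \<open>D\<close>. The
  latter is \<open>s\<close> minus the \<open>i\<close>-th smallest eigenvalue of \<open>B\<close>. Thus the \<open>i\<close>-th term of the hinge sum on the left
  is at most the growth of the \<open>i\<close>-th eigenvalue from \<open>D\<close> to \<open>D + P\<close>, and these growths add up to \<open>tr P\<close>,
  the hinge sum on the right.
\<close>

theorem lidskii_submajorization:
  fixes A B :: "complex^'d^'d"
  assumes A: "hermitian A" and B: "hermitian B"
  shows "submajorized (opposed_sum A B) (eigvals (A + B))"
proof -
  let ?d = "CARD('d)"
  have AB: "hermitian (A + B)" using A B by (rule hermitian_add)
  obtain w where w: "orthonormal_basis w" "A + B = spectral_sum w (\<lambda>j. eigvals (A + B) ! j)"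
    using spectral_decomposition[OF AB] .
  obtain v where v: "orthonormal_basis v" "B = spectral_sum v (\<lambda>j. eigvals B ! (?d - 1 - j))"
    using reversed_spectral_decomposition[OF B] .
  have "hinge_sum s (opposed_sum A B) \<le> hinge_sum s (eigvals (A + B))" for s
  proof -
    define P where "P = spectral_sum w (\<lambda>j. max 0 (eigvals (A + B) ! j - s))"
    define D where "D = spectral_sum v (\<lambda>j. s - eigvals B ! (?d - 1 - j))"
    have herm: "hermitian P" "hermitian D" "hermitian (D + P)"
      by (auto simp: P_def D_def hermitian_spectral_sum intro: hermitian_add)
    have P0: "0 \<le> inner (P *v x) x" for x
      unfolding P_def inner_spectral_sum by (intro sum_nonneg) auto
    have D: "inner (D *v x) x = s * (norm x)\<^sup>2 - inner (B *v x) x" for x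
      unfolding inner_of_decomposition[OF v, of x] parseval[OF v(1), of x] D_def inner_spectral_sum
      by (simp add: algebra_simps sum_subtractf sum_distrib_left)
    have AD: "inner (A *v x) x \<le> inner ((D + P) *v x) x" for x
    proof -
      have "inner ((A + B) *v x) x \<le> (\<Sum>j<?d. (s + max 0 (eigvals (A + B) ! j - s)) * (cmod (cinner x (w j)))\<^sup>2)"
        unfolding inner_of_decomposition[OF w] by (intro sum_mono mult_right_mono) auto
      also have "\<dots> = s * (norm x)\<^sup>2 + inner (P *v x) x"
        unfolding parseval[OF w(1), of x] P_def inner_spectral_sum
        by (simp add: algebra_simps sum.distrib sum_distrib_left)
      finally show ?thesis using D by (simp add: matrix_vector_mult_add_rdistrib inner_add_left)
    qed
    have eD: "eigvals D ! i = s - eigvals B ! (?d - 1 - i)" if "i < ?d" for i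
    proof -
      have "eigvals D = map (\<lambda>j. s - eigvals B ! (?d - 1 - j)) [0..<?d]"
        unfolding D_def eigvals_spectral_sum[OF v(1)]
        by (intro decr_ident) (auto simp: sorted_wrt_iff_nth_less intro!: eigvals_antimono[OF B])
      then show ?thesis using that by simp
    qed
    have "hinge_sum s (opposed_sum A B) = (\<Sum>i<?d. max 0 (eigvals A ! i + eigvals B ! (?d - 1 - i) - s))"
      unfolding hinge_sum_nth by (intro sum.cong) (auto simp: opposed_sum_nth[OF A B])
    also have "\<dots> \<le> (\<Sum>i<?d. eigvals (D + P) ! i - eigvals D ! i)"
    proof (rule sum_mono)
      fix i assume i: "i \<in> {..<?d}"
      have "eigvals A ! i \<le> eigvals (D + P) ! i"
        using i by (intro eigvals_mono[OF A herm(3) AD]) auto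
      moreover have "eigvals D ! i \<le> eigvals (D + P) ! i"
        using i P0 by (intro eigvals_mono[OF herm(2,3)]) (auto simp: matrix_vector_mult_add_rdistrib inner_add_left)
      ultimately show "max 0 (eigvals A ! i + eigvals B ! (?d - 1 - i) - s) \<le> eigvals (D + P) ! i - eigvals D ! i"
        using eD[of i] i by auto
    qed
    also have "\<dots> = Re (trace P)"
      by (simp add: sum_subtractf sum_eigvals herm trace_add)
    also have "\<dots> = (\<Sum>j<?d. max 0 (eigvals (A + B) ! j - s))"
      unfolding P_def trace_spectral_sum[OF w(1)] by simp
    also have "\<dots> = hinge_sum s (eigvals (A + B))"
      unfolding hinge_sum_nth length_eigvals[OF AB] ..
    finally show ?thesis .
  qed
  then show ?thesis
    using opposed_sum_nth(1)[OF A B] length_eigvals[OF AB] by (simp add: submajorized_iff_hinge_sum)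
qed

lemma matrix_mult_tensor: "M ** tensor x y = tensor (M *v x) y"
  by (simp add: vec_eq_iff matrix_matrix_mult_def tensor_def matrix_vector_mult_def sum_distrib_left
      sum_distrib_right mult_ac)

lemma matrix_mult_sum_right: "M ** (\<Sum>j\<in>I. N j) = (\<Sum>j\<in>I. M ** N j)" for N :: "'a \<Rightarrow> complex^'m^'n"
  by (induction I rule: infinite_finite_induct) (simp_all add: matrix_add_ldistrib)

lemma matrix_mult_add_left: "(M + N) ** X = M ** X + N ** X" for M N :: "complex^'m^'n"
  by (simp add: vec_eq_iff matrix_matrix_mult_def distrib_right sum.distrib)

lemma matrix_mult_scaleR_right: "M ** (r *\<^sub>R N) = r *\<^sub>R (M ** N)" for N :: "complex^'m^'n"
  by (simp add: vec_eq_iff matrix_matrix_mult_def scaleR_sum_right)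

lemma trace_mult_spectral_sum:
  "Re (trace (M ** spectral_sum u a)) = (\<Sum>i<CARD('d). a i * inner (M *v u i) (u i))"
  for M :: "complex^'d^'d"
  by (simp add: spectral_sum_def matrix_mult_sum_right matrix_mult_scaleR_right matrix_mult_tensor
      trace_sum trace_scaleR trace_tensor Re_cinner)

lemma eigenvalues_eq_if_not_orthogonal:
  assumes A: "hermitian A" and x: "A *v x = complex_of_real \<alpha> *s x"
    and y: "A *v y = complex_of_real \<beta> *s y" and ne: "cinner x y \<noteq> 0"
  shows "\<alpha> = \<beta>"
  using hermitian_cinner[OF A, of x y] ne by (simp add: x y cinner_scale_left cinner_scale_right)

text \<open>
  In eigenbases \<open>u\<close> of \<open>A\<close> and \<open>w\<close> of \<open>B\<close> the trace is \<open>\<Sum> a\<^sub>i b\<^sub>j W\<^sub>i\<^sub>j\<close> with the doubly stochastic matrix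
  \<open>W\<^sub>i\<^sub>j = |\<langle>u\<^sub>i, w\<^sub>j\<rangle>|\<^sup>2\<close>, so a minimal trace restricts its support. The statement for arbitrary eigenvectors
  follows, since two eigenvectors that are not orthogonal to each other overlap with some \<open>u\<^sub>i\<close>, \<open>w\<^sub>j\<close> of the
  same eigenvalues for which \<open>W\<^sub>i\<^sub>j > 0\<close>.
\<close>

lemma minimal_trace_opposed_eigenvalues:
  fixes A B :: "complex^'d^'d"
  assumes A: "hermitian A" and B: "hermitian B"
    and min: "Re (trace (A ** B)) = (\<Sum>i<CARD('d). eigvals A ! i * eigvals B ! (CARD('d) - 1 - i))"
    and x: "A *v x = complex_of_real \<alpha> *s x" "A *v x' = complex_of_real \<alpha>' *s x'"
    and y: "B *v y = complex_of_real \<beta> *s y" "B *v y' = complex_of_real \<beta>' *s y'"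
    and ne: "cinner x y \<noteq> 0" "cinner x' y' \<noteq> 0" and less: "\<alpha>' < \<alpha>"
  shows "\<beta> \<le> \<beta>'"
proof -
  let ?d = "CARD('d)"
  define a where "a i = eigvals A ! i" for i
  define b where "b i = eigvals B ! (?d - 1 - i)" for i
  obtain u where u: "orthonormal_basis u" "A = spectral_sum u a"
    using spectral_decomposition[OF A] unfolding a_def .
  obtain w where w: "orthonormal_basis w" "B = spectral_sum w b"
    using reversed_spectral_decomposition[OF B] unfolding b_def .
  have Au: "A *v u i = complex_of_real (a i) *s u i" if "i < ?d" for i
    using spectral_sum_eigenvector[OF u(1) that] u(2) by simp
  have Bw: "B *v w i = complex_of_real (b i) *s w i" if "i < ?d" for i
    using spectral_sum_eigenvector[OF w(1) that] w(2) by simp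
  define W where "W i j = (cmod (cinner (u i) (w j)))\<^sup>2" for i j
  have nu: "(norm (u i))\<^sup>2 = 1" if "i < ?d" for i
    by (simp add: orthonormal_basis_norm[OF u(1) that])
  have nw: "(norm (w i))\<^sup>2 = 1" if "i < ?d" for i
    by (simp add: orthonormal_basis_norm[OF w(1) that])
  have Wsym: "W i j = (cmod (cinner (w j) (u i)))\<^sup>2" for i j
    unfolding W_def by (subst cinner_commute) simp
  have "Re (trace (A ** B)) = Re (trace (B ** spectral_sum u a))"
    by (metis trace_mul_sym u(2))
  also have "\<dots> = (\<Sum>i<?d. a i * (\<Sum>j<?d. b j * W i j))"
    unfolding trace_mult_spectral_sum inner_of_decomposition[OF w] W_def ..
  finally have eq: "(\<Sum>i<?d. \<Sum>j<?d. a i * b j * W i j) = (\<Sum>i<?d. a i * b i)"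
    using min by (simp add: a_def b_def sum_distrib_left mult.assoc)
  have witness: "\<exists>i<?d. \<exists>j<?d. a i = \<gamma> \<and> b j = \<delta> \<and> 0 < W i j"
    if z: "A *v z = complex_of_real \<gamma> *s z" "B *v z' = complex_of_real \<delta> *s z'" "cinner z z' \<noteq> 0" for z z' \<gamma> \<delta>
  proof -
    obtain i where i: "i < ?d" "cinner z (u i) * cinner (u i) z' \<noteq> 0"
      using z(3) unfolding parseval_cinner[OF u(1), of z z'] by (meson lessThan_iff sum.not_neutral_contains_not_neutral)
    then have "cinner (u i) z' \<noteq> 0" by simp
    then obtain j where j: "j < ?d" "cinner (u i) (w j) * cinner (w j) z' \<noteq> 0"
      unfolding parseval_cinner[OF w(1), of "u i" z'] by (meson lessThan_iff sum.not_neutral_contains_not_neutral)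
    have "\<gamma> = a i" using i by (intro eigenvalues_eq_if_not_orthogonal[OF A z(1) Au]) auto
    moreover have "b j = \<delta>" using j by (intro eigenvalues_eq_if_not_orthogonal[OF B Bw z(2)]) auto
    ultimately show ?thesis using i j by (auto simp: W_def)
  qed
  obtain p q where pq: "p < ?d" "q < ?d" "a p = \<alpha>" "b q = \<beta>" "0 < W p q"
    using witness[OF x(1) y(1) ne(1)] by blast
  obtain r s where rs: "r < ?d" "s < ?d" "a r = \<alpha>'" "b s = \<beta>'" "0 < W r s"
    using witness[OF x(2) y(2) ne(2)] by blast
  have "b q \<le> b s"
  proof (rule doubly_stochastic_support[of ?d W a b p q r s])
    show "(\<Sum>j<?d. W i j) = 1" if "i < ?d" for i
      using parseval[OF w(1), of "u i"] nu[OF that] by (simp add: W_def)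
    show "(\<Sum>i<?d. W i j) = 1" if "j < ?d" for j
      using parseval[OF u(1), of "w j"] nw[OF that] by (simp add: Wsym)
    show "a j \<le> a i" if "i \<le> j" "j < ?d" for i j
      unfolding a_def using that by (rule eigvals_antimono[OF A])
    show "b i \<le> b j" if "i \<le> j" "j < ?d" for i j
      unfolding b_def using that by (intro eigvals_antimono[OF B]) auto
  qed (use pq rs eq less in \<open>auto simp: W_def\<close>)
  then show ?thesis using pq rs by simp
qed

text \<open>
  It suffices that \<open>B\<close> has no matrix entry between eigenvectors \<open>u p\<close>, \<open>u r\<close> of \<open>A\<close> with different
  eigenvalues. Only those \<open>w j\<close> contribute to this entry that overlap with both of them, and by
  \<open>minimal_trace_opposed_eigenvalues\<close> they all have the same eigenvalue \<open>\<beta>\<close>. Hence the entry is \<open>\<beta> \<langle>u p, u r\<rangle> = 0\<close>.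
\<close>

lemma minimal_trace_commute:
  fixes A B :: "complex^'d^'d"
  assumes A: "hermitian A" and B: "hermitian B"
    and min: "Re (trace (A ** B)) = (\<Sum>i<CARD('d). eigvals A ! i * eigvals B ! (CARD('d) - 1 - i))"
  shows "A ** B = B ** A"
proof -
  let ?d = "CARD('d)"
  obtain u where u: "orthonormal_basis u" "A = spectral_sum u (\<lambda>j. eigvals A ! j)"
    using spectral_decomposition[OF A] .
  obtain w where w: "orthonormal_basis w" "B = spectral_sum w (\<lambda>j. eigvals B ! j)"
    using spectral_decomposition[OF B] .
  define a where "a i = eigvals A ! i" for i
  define b where "b i = eigvals B ! i" for i
  have Au: "A *v u i = complex_of_real (a i) *s u i" if "i < ?d" for i
    using spectral_sum_eigenvector[OF u(1) that] u(2) by (metis a_def)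
  have Bw: "B *v w i = complex_of_real (b i) *s w i" if "i < ?d" for i
    using spectral_sum_eigenvector[OF w(1) that] w(2) by (metis b_def)
  have offdiag: "cinner (B *v u p) (u r) = 0" if pr: "p < ?d" "r < ?d" "a r < a p" for p r
  proof -
    define c where "c j = cinner (u p) (w j) * cinner (w j) (u r)" for j
    have cmp: "b i \<le> b j" if "i < ?d" "j < ?d" "c i \<noteq> 0" "c j \<noteq> 0" for i j
      using that pr cinner_eq_0_commute[of "w j" "u r"] unfolding c_def
      by (intro minimal_trace_opposed_eigenvalues[OF A B min Au[OF pr(1)] Au[OF pr(2)] Bw[OF that(1)] Bw[OF that(2)]]) auto
    have "\<exists>\<beta>. \<forall>j<?d. c j \<noteq> 0 \<longrightarrow> b j = \<beta>"
      using cmp by (metis order_antisym)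
    then obtain \<beta> where \<beta>: "\<And>j. j < ?d \<Longrightarrow> c j \<noteq> 0 \<Longrightarrow> b j = \<beta>" by blast
    have "cinner (B *v u p) (u r) = (\<Sum>j<?d. cinner (B *v u p) (w j) * cinner (w j) (u r))"
      by (rule parseval_cinner[OF w(1)])
    also have "\<dots> = (\<Sum>j<?d. complex_of_real (b j) * c j)"
      by (intro sum.cong) (auto simp: hermitian_cinner[OF B] Bw cinner_scale_right c_def)
    also have "\<dots> = (\<Sum>j<?d. complex_of_real \<beta> * c j)"
      using \<beta> by (intro sum.cong) auto
    also have "\<dots> = complex_of_real \<beta> * cinner (u p) (u r)"
      unfolding c_def parseval_cinner[OF w(1), of "u p" "u r"] sum_distrib_left ..
    also have "\<dots> = 0" using orthonormal_basis_cinner[OF u(1) pr(1,2)] pr(3) by auto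
    finally show ?thesis .
  qed
  have offdiag': "cinner (B *v u k) (u i) = 0" if "i < ?d" "k < ?d" "a i \<noteq> a k" for i k
  proof (cases "a i < a k")
    case True
    then show ?thesis using offdiag that by blast
  next
    case False
    then have "cinner (B *v u i) (u k) = 0" using offdiag that by auto
    then show ?thesis using hermitian_cinner[OF B, of "u k" "u i"] cinner_eq_0_commute by metis
  qed
  show ?thesis
  proof (rule matrix_eq_on_basis[OF u(1)])
    fix k assume k: "k < ?d"
    have "cinner (A *v (B *v u k)) (u i) = cinner (B *v (A *v u k)) (u i)" if "i < ?d" for i
      using offdiag'[OF that k] that k
      by (cases "a i = a k") (simp_all add: hermitian_cinner[OF A] Au vec.scale cinner_scale_left cinner_scale_right)
    then have "(\<Sum>i<?d. cinner (A *v (B *v u k)) (u i) *s u i) = (\<Sum>i<?d. cinner (B *v (A *v u k)) (u i) *s u i)"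
      by (intro sum.cong) auto
    then have "A *v (B *v u k) = B *v (A *v u k)"
      unfolding basis_expansion[OF u(1), symmetric] .
    then show "(A ** B) *v u k = (B ** A) *v u k" by (simp add: matrix_vector_mul_assoc)
  qed
qed

text \<open>
  Equal sums of squares mean that \<open>tr (A B)\<close> is minimal, so there is a common eigenbasis, in which a
  larger eigenvalue \<open>\<alpha>\<close> of \<open>A\<close> never comes with a larger eigenvalue \<open>\<beta>\<close> of \<open>B\<close>. Sorting the basis by
  \<open>\<beta> - \<alpha>\<close> therefore sorts both spectra, including the ties.
\<close>

theorem lidskii_equality:
  fixes A B :: "complex^'d^'d"
  assumes A: "hermitian A" and B: "hermitian B"
    and eq: "mset (opposed_sum A B) = mset (eigvals (A + B))"
  obtains v where "orthonormal_basis v" "A = spectral_sum v (\<lambda>j. eigvals A ! j)"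
    "B = spectral_sum v (\<lambda>j. rev (eigvals B) ! j)"
proof -
  let ?d = "CARD('d)"
  define a where "a i = eigvals A ! i" for i
  define b where "b i = eigvals B ! (?d - 1 - i)" for i
  have AB: "hermitian (A + B)" using A B by (rule hermitian_add)
  have "sum_list (map (\<lambda>x. x\<^sup>2) (opposed_sum A B)) = sum_list (map (\<lambda>x. x\<^sup>2) (eigvals (A + B)))"
    by (rule sum_list_map_mset_cong[OF eq])
  then have "(\<Sum>i<?d. (opposed_sum A B ! i)\<^sup>2) = (\<Sum>i<?d. (eigvals (A + B) ! i)\<^sup>2)"
    by (simp add: sum_list_sum_nth atLeast0LessThan opposed_sum_nth(1)[OF A B] length_eigvals[OF AB])
  then have "(\<Sum>i<?d. (a i + b i)\<^sup>2) = Re (trace ((A + B) ** (A + B)))"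
    unfolding sum_eigvals_sq[OF AB] a_def b_def by (simp add: opposed_sum_nth(2)[OF A B])
  also have "\<dots> = Re (trace (A ** A)) + Re (trace (B ** B)) + 2 * Re (trace (A ** B))"
    by (simp add: matrix_add_ldistrib matrix_mult_add_left trace_add trace_mul_sym[of B A])
  also have "Re (trace (A ** A)) = (\<Sum>i<?d. (a i)\<^sup>2)"
    unfolding a_def by (rule sum_eigvals_sq[OF A, symmetric])
  also have "Re (trace (B ** B)) = (\<Sum>i<?d. (b i)\<^sup>2)"
    unfolding b_def sum_eigvals_sq[OF B, symmetric]
    by (rule sum.reindex_bij_betw[OF reversal_bij, symmetric])
  finally have min: "Re (trace (A ** B)) = (\<Sum>i<?d. a i * b i)"
    by (simp add: power2_sum sum.distrib mult.assoc flip: sum_distrib_left)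
  have min': "Re (trace (A ** B)) = (\<Sum>i<?d. eigvals A ! i * eigvals B ! (?d - 1 - i))"
    using min by (simp add: a_def b_def)
  obtain v \<alpha> \<beta> where v: "orthonormal_basis v"
    and Av: "\<And>i. i < ?d \<Longrightarrow> A *v v i = complex_of_real (\<alpha> i) *s v i"
    and Bv: "\<And>i. i < ?d \<Longrightarrow> B *v v i = complex_of_real (\<beta> i) *s v i"
    using commuting_hermitian_common_basis[OF A B minimal_trace_commute[OF A B min']] by metis
  \<comment> \<open>A common eigenvector is not orthogonal to itself.\<close>
  have opp: "\<beta> i \<le> \<beta> j" if "i < ?d" "j < ?d" "\<alpha> j < \<alpha> i" for i j
    using that orthonormal_basis_cinner[OF v]
    by (intro minimal_trace_opposed_eigenvalues[OF A B min' Av[OF that(1)] Av[OF that(2)] Bv[OF that(1)] Bv[OF that(2)]]) auto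
  obtain p where p: "bij_betw p {..<?d} {..<?d}"
    "\<And>i j. i \<le> j \<Longrightarrow> j < ?d \<Longrightarrow> \<beta> (p i) - \<alpha> (p i) \<le> \<beta> (p j) - \<alpha> (p j)"
    using sorting_permutation[of ?d "\<lambda>i. \<beta> i - \<alpha> i"] by metis
  have pd: "p i < ?d" if "i < ?d" for i using p(1) that by (auto simp: bij_betw_def)
  have \<alpha>p: "\<alpha> (p j) \<le> \<alpha> (p i)" if "i \<le> j" "j < ?d" for i j
    using p(2)[OF that] opp[of "p j" "p i"] pd that by (cases "\<alpha> (p i) < \<alpha> (p j)") auto
  have \<beta>p: "\<beta> (p i) \<le> \<beta> (p j)" if "i \<le> j" "j < ?d" for i j
    using p(2)[OF that] opp[of "p i" "p j"] \<alpha>p[OF that] pd that by (cases "\<alpha> (p j) < \<alpha> (p i)") auto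
  have vp: "orthonormal_basis (v \<circ> p)" "A = spectral_sum (v \<circ> p) (\<alpha> \<circ> p)" "B = spectral_sum (v \<circ> p) (\<beta> \<circ> p)"
    using spectral_sum_permute[OF p(1) v] Av Bv eq_spectral_sum_iff[OF v, of A] eq_spectral_sum_iff[OF v, of B] by auto
  have "eigvals A = decr (map (\<alpha> \<circ> p) [0..<?d])"
    using eigvals_spectral_sum[OF vp(1)] vp(2) by metis
  also have "\<dots> = map (\<alpha> \<circ> p) [0..<?d]"
    using \<alpha>p by (intro decr_ident) (auto simp: sorted_wrt_iff_nth_less)
  finally have eA: "eigvals A ! j = (\<alpha> \<circ> p) j" if "j < ?d" for j using that by simp
  have "eigvals B = decr (map (\<beta> \<circ> p) [0..<?d])"
    using eigvals_spectral_sum[OF vp(1)] vp(3) by metis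
  also have "\<dots> = decr (rev (map (\<beta> \<circ> p) [0..<?d]))"
    by (rule decr_cong) simp
  also have "\<dots> = rev (map (\<beta> \<circ> p) [0..<?d])"
    using \<beta>p by (intro decr_ident) (auto simp: sorted_wrt_iff_nth_less rev_nth)
  finally have eB: "rev (eigvals B) ! j = (\<beta> \<circ> p) j" if "j < ?d" for j using that by simp
  show ?thesis
  proof (rule that[OF vp(1)])
    show "A = spectral_sum (v \<circ> p) (\<lambda>j. eigvals A ! j)" using vp(2) eA spectral_sum_cong by metis
    show "B = spectral_sum (v \<circ> p) (\<lambda>j. rev (eigvals B) ! j)" using vp(3) eB spectral_sum_cong by metis
  qed
qed

section \<open>Dual frames and their perturbations\<close>

lemma vec_eq_on_basis:
  fixes v :: "nat \<Rightarrow> complex^'d"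
  assumes v: "orthonormal_basis v" and eq: "\<And>i. i < CARD('d) \<Longrightarrow> cinner x (v i) = cinner y (v i)"
  shows "x = y"
proof -
  have "(\<Sum>i<CARD('d). cinner x (v i) *s v i) = (\<Sum>i<CARD('d). cinner y (v i) *s v i)"
    using eq by (intro sum.cong) auto
  then show ?thesis unfolding basis_expansion[OF v, symmetric] .
qed

lemma cadjoint_cadjoint [simp]: "cadjoint (cadjoint A) = A"
  by (simp add: cadjoint_def vec_eq_iff)

lemma cadjoint_0 [simp]: "cadjoint 0 = 0"
  by (simp add: cadjoint_def vec_eq_iff)

lemma cadjoint_mat_1 [simp]: "cadjoint (mat 1) = mat 1"
  by (simp add: cadjoint_def vec_eq_iff mat_def)

lemma cadjoint_mult: "cadjoint (A ** B) = cadjoint B ** cadjoint A"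
  by (simp add: cadjoint_def vec_eq_iff matrix_matrix_mult_def mult.commute)

lemma cinner_cadjoint_left: "cinner (cadjoint A *v x) y = cinner x (A *v y)"
  using cinner_cadjoint[of "cadjoint A" x y] by simp

lemma matrix_mult_0: "A ** (0 :: complex^'m^'n) = 0" "(0 :: complex^'m^'n) ** B = 0"
  by (simp_all add: vec_eq_iff matrix_matrix_mult_def)

lemma hermitian_frame_op: "hermitian (frame_op K)"
  by (simp add: hermitian_def frame_op_def cadjoint_mult)

lemma cinner_frame_op: "cinner (analysis_op K *v x) (analysis_op K *v y) = cinner x (frame_op K *v y)"
  by (simp add: cinner_cadjoint frame_op_def matrix_vector_mul_assoc)

lemma inner_frame_op: "inner (frame_op K *v x) x = (norm (analysis_op K *v x))\<^sup>2"
proof -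
  have "inner x (frame_op K *v x) = (norm (analysis_op K *v x))\<^sup>2"
    by (simp flip: Re_cinner cinner_frame_op add: cinner_self)
  then show ?thesis by (simp add: inner_commute)
qed

lemma trace_frame_op: "trace (frame_op K) = of_real (\<Sum>j\<in>UNIV. (norm (K j))\<^sup>2)"
  by (simp add: frame_op_eq_sum trace_sum trace_tensor cinner_self)

lemma frame_op_eigvals_eq:
  fixes K :: "'n::finite \<Rightarrow> complex^'d" and v :: "nat \<Rightarrow> complex^'d"
  assumes v: "orthonormal_basis v" "frame_op K = spectral_sum v b" and j: "j < CARD('d)"
  shows "b j = (norm (analysis_op K *v v j))\<^sup>2"
proof -
  have "complex_of_real (b j) = cinner (frame_op K *v v j) (v j)"
    using v(2) orthonormal_basis_cinner[OF v(1) j j]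
    by (simp add: spectral_sum_eigenvector[OF v(1) j] cinner_scale_left)
  then have "b j = inner (frame_op K *v v j) (v j)" by (metis Re_cinner Re_complex_of_real)
  then show ?thesis by (simp add: inner_frame_op)
qed

lemma frame_op_eigvals_nonneg:
  fixes K :: "'n::finite \<Rightarrow> complex^'d"
  assumes "x \<in> set (eigvals (frame_op K))"
  shows "0 \<le> x"
proof -
  obtain v where v: "orthonormal_basis v" "frame_op K = spectral_sum v (\<lambda>j. eigvals (frame_op K) ! j)"
    using spectral_decomposition[OF hermitian_frame_op] .
  then show ?thesis
    using assms frame_op_eigvals_eq[OF v] length_eigvals[OF hermitian_frame_op[of K]]
    by (auto simp: in_set_conv_nth)
qed

lemma analysis_op_injective:
  fixes F :: "'n::finite \<Rightarrow> complex^'d"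
  assumes frame: "is_frame F" and 0: "analysis_op F *v x = 0"
  shows "x = 0"
proof -
  have orth: "cinner x (F i) = 0" for i using 0 by (simp add: analysis_op_mult vec_eq_iff)
  have "vec.subspace {y. cinner x y = 0}"
    by (rule vec.subspaceI) (auto simp: cinner_add_right cinner_scale_right)
  then have "vec.span (range F) \<subseteq> {y. cinner x y = 0}"
    using orth by (intro vec.span_minimal) auto
  then have "x \<in> {y. cinner x y = 0}" using frame unfolding is_frame_def by blast
  then show ?thesis by simp
qed

lemma frame_op_inverse:
  fixes F :: "'n::finite \<Rightarrow> complex^'d"
  assumes frame: "is_frame F"
  shows "frame_op F ** matrix_inv (frame_op F) = mat 1" "matrix_inv (frame_op F) ** frame_op F = mat 1"
proof -
  have "x = 0" if "frame_op F *v x = 0" for x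
  proof -
    have "(norm (analysis_op F *v x))\<^sup>2 = 0" using that inner_frame_op[of F x] by simp
    then show ?thesis using analysis_op_injective[OF frame] by simp
  qed
  then obtain B where B: "B ** frame_op F = mat 1"
    using matrix_left_invertible_ker[of "frame_op F"] by blast
  then have "\<exists>B. frame_op F ** B = mat 1 \<and> B ** frame_op F = mat 1"
    using matrix_left_right_inverse by blast
  from someI_ex[OF this]
  show "frame_op F ** matrix_inv (frame_op F) = mat 1" "matrix_inv (frame_op F) ** frame_op F = mat 1"
    by (simp_all add: matrix_inv_def)
qed

lemma analysis_op_canonical_dual:
  fixes F :: "'n::finite \<Rightarrow> complex^'d"
  assumes frame: "is_frame F"
  shows "analysis_op (canonical_dual F) = analysis_op F ** matrix_inv (frame_op F)"
proof -
  let ?R = "matrix_inv (frame_op F)"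
  have "cadjoint ?R = cadjoint ?R ** (frame_op F ** ?R)"
    by (simp add: frame_op_inverse[OF frame] matrix_mul_rid)
  also have "\<dots> = cadjoint (frame_op F ** ?R) ** ?R"
    using hermitian_frame_op[of F] by (simp add: cadjoint_mult hermitian_def matrix_mul_assoc)
  also have "\<dots> = ?R" by (simp add: frame_op_inverse[OF frame] matrix_mul_lid)
  finally have R: "cadjoint ?R = ?R" .
  have "analysis_op (canonical_dual F) = analysis_op F ** cadjoint ?R"
    by (simp add: vec_eq_iff analysis_op_def canonical_dual_def matrix_matrix_mult_def
        matrix_vector_mult_def cadjoint_def mult.commute)
  then show ?thesis by (simp add: R)
qed

lemma canonical_dual_is_dual:
  assumes "is_frame F"
  shows "cadjoint (analysis_op F) ** analysis_op (canonical_dual F) = mat 1"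
  unfolding analysis_op_canonical_dual[OF assms] matrix_mul_assoc
  using frame_op_inverse(1)[OF assms] by (simp add: frame_op_def)

lemma analysis_op_add: "analysis_op (\<lambda>i. G i + K i) = analysis_op G + analysis_op K"
  by (simp add: analysis_op_def vec_eq_iff)

lemma dual_frame_iff:
  assumes "is_frame F"
  shows "(\<lambda>i. canonical_dual F i + K i) \<in> dual_frames F \<longleftrightarrow> cadjoint (analysis_op F) ** analysis_op K = 0"
  by (simp add: dual_frames_def analysis_op_add matrix_add_ldistrib canonical_dual_is_dual[OF assms])

lemma frame_op_dual:
  assumes frame: "is_frame F" and K: "cadjoint (analysis_op F) ** analysis_op K = 0"
  shows "frame_op (\<lambda>i. canonical_dual F i + K i) = frame_op (canonical_dual F) + frame_op K"
proof -
  let ?T = "analysis_op (canonical_dual F)" and ?K = "analysis_op K"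
  have 1: "cadjoint ?T ** ?K = 0"
    using K by (simp add: analysis_op_canonical_dual[OF frame] cadjoint_mult matrix_mult_0
        flip: matrix_mul_assoc)
  then have "cadjoint (cadjoint ?T ** ?K) = 0" by simp
  then have 2: "cadjoint ?K ** ?T = 0" by (simp add: cadjoint_mult)
  show ?thesis
    unfolding frame_op_def analysis_op_add cadjoint_add matrix_add_ldistrib matrix_mult_add_left
    by (simp add: 1 2)
qed

text \<open>
  The bound on the norm is used pointwise, as \<open>S\<^sub>K \<le> \<epsilon>\<^sup>2\<close>.
\<close>

lemma spectral_norm_le_iff:
  assumes "0 \<le> \<epsilon>"
  shows "spectral_norm A \<le> \<epsilon> \<longleftrightarrow> (\<forall>x. norm (A *v x) \<le> \<epsilon> * norm x)"
proof
  assume le: "spectral_norm A \<le> \<epsilon>"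
  show "\<forall>x. norm (A *v x) \<le> \<epsilon> * norm x"
  proof
    fix x
    have "norm (A *v x) \<le> spectral_norm A * norm x"
      unfolding spectral_norm_def by (rule onorm) (rule matrix_vector_mul_bounded_linear)
    also have "\<dots> \<le> \<epsilon> * norm x" using le by (rule mult_right_mono) simp
    finally show "norm (A *v x) \<le> \<epsilon> * norm x" .
  qed
next
  assume "\<forall>x. norm (A *v x) \<le> \<epsilon> * norm x"
  then show "spectral_norm A \<le> \<epsilon>" unfolding spectral_norm_def by (intro onorm_bound assms) auto
qed

text \<open>
  The images under \<open>T\<^sub>F\<close> of an eigenbasis of \<open>S\<^sub>F\<close>, together with the images under \<open>T\<^sub>K\<close> of the
  eigenvectors of \<open>S\<^sub>K\<close> with nonzero eigenvalue, are nonzero and pairwise orthogonal in a space of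
  dimension \<open>n\<close>.
\<close>

lemma card_nonzero_eigenvalues_le:
  fixes F K :: "'n::finite \<Rightarrow> complex^'d" and v :: "nat \<Rightarrow> complex^'d"
  assumes frame: "is_frame F" and K: "cadjoint (analysis_op F) ** analysis_op K = 0"
    and v: "orthonormal_basis v" "frame_op K = spectral_sum v b"
  shows "card {j. j < CARD('d) \<and> b j \<noteq> 0} + CARD('d) \<le> CARD('n)"
proof -
  let ?d = "CARD('d)" and ?J = "{j. j < CARD('d) \<and> b j \<noteq> 0}"
  obtain u where u: "orthonormal_basis u" "frame_op F = spectral_sum u (\<lambda>j. eigvals (frame_op F) ! j)"
    using spectral_decomposition[OF hermitian_frame_op] .
  have Fu: "frame_op F *v u i = complex_of_real (eigvals (frame_op F) ! i) *s u i" if "i < ?d" for i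
    using spectral_sum_eigenvector[OF u(1) that] u(2) by metis
  have Kv: "frame_op K *v v i = complex_of_real (b i) *s v i" if "i < ?d" for i
    using spectral_sum_eigenvector[OF v(1) that] v(2) by metis
  define f :: "nat + nat \<Rightarrow> complex^'n"
    where "f = case_sum (\<lambda>i. analysis_op F *v u i) (\<lambda>j. analysis_op K *v v j)"
  have cross: "cinner (analysis_op F *v x) (analysis_op K *v y) = 0" for x y
  proof -
    have "cinner (analysis_op F *v x) (analysis_op K *v y)
        = cinner x ((cadjoint (analysis_op F) ** analysis_op K) *v y)"
      by (simp only: cinner_cadjoint matrix_vector_mul_assoc)
    then show ?thesis by (simp add: K)
  qed
  have "card ({..<?d} <+> ?J) \<le> CARD('n)"
  proof (rule orthogonal_family_card_le[of _ f])
    fix i assume i: "i \<in> {..<?d} <+> ?J"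
    show "f i \<noteq> 0"
    proof (cases i)
      case (Inl k)
      then have k: "k < ?d" using i by auto
      have "u k \<noteq> 0" using orthonormal_basis_cinner[OF u(1) k k] by auto
      then show ?thesis using analysis_op_injective[OF frame] Inl by (auto simp: f_def)
    next
      case (Inr k)
      then have "k < ?d" "b k \<noteq> 0" using i by auto
      then show ?thesis using frame_op_eigvals_eq[OF v] Inr by (auto simp: f_def)
    qed
    fix j assume j: "j \<in> {..<?d} <+> ?J" and ne: "i \<noteq> j"
    show "cinner (f i) (f j) = 0"
      using i j ne cross cinner_eq_0_commute[of "analysis_op K *v _" "analysis_op F *v _"]
      by (auto simp: f_def cinner_frame_op Fu Kv cinner_scale_right orthonormal_basis_cinner[OF u(1)]
          orthonormal_basis_cinner[OF v(1)] split: if_splits)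
  qed auto
  then show ?thesis by (simp add: card_Plus)
qed

lemma orthonormal_in_kernel_exists:
  fixes T :: "complex^'d^'n"
  assumes "k + CARD('d) \<le> CARD('n)"
  shows "\<exists>y. orthonormal_upto k y \<and> (\<forall>j<k. cadjoint T *v y j = 0)"
  using assms
proof (induction k)
  case 0
  show ?case by (simp add: orthonormal_upto_def)
next
  case (Suc k)
  then obtain y where y: "orthonormal_upto k y" "\<And>j. j < k \<Longrightarrow> cadjoint T *v y j = 0" by auto
  obtain v :: "nat \<Rightarrow> complex^'d" where v: "orthonormal_basis v"
    using spectral_decomposition[of "mat 1 :: complex^'d^'d"] by (auto simp: hermitian_def)
  let ?S = "y ` {..<k} \<union> (\<lambda>i. T *v v i) ` {..<CARD('d)}"
  have "card ?S \<le> card (y ` {..<k}) + card ((\<lambda>i. T *v v i) ` {..<CARD('d)})" by (rule card_Un_le)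
  also have "\<dots> \<le> k + CARD('d)"
    using card_image_le[of "{..<k}" y] card_image_le[of "{..<CARD('d)}" "\<lambda>i. T *v v i"] by simp
  also have "\<dots> < CARD('n)" using Suc.prems by simp
  finally obtain x :: "complex^'n" where x: "norm x = 1" "\<And>z. z \<in> ?S \<Longrightarrow> cinner x z = 0"
    using exists_orthogonal_vector[of ?S] by blast
  have xy: "cinner x (y i) = 0" "cinner (y i) x = 0" if "i < k" for i
    using x(2)[of "y i"] that cinner_eq_0_commute[of x "y i"] by auto
  have "cadjoint T *v x = 0"
    using x(2) by (intro vec_eq_on_basis[OF v]) (simp add: cinner_cadjoint_left)
  then have "\<forall>j<Suc k. cadjoint T *v (y(k := x)) j = 0" using y(2) by (auto simp: less_Suc_eq)
  moreover have "orthonormal_upto (Suc k) (y(k := x))"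
    using y(1) x(1) xy by (auto simp: orthonormal_upto_def less_Suc_eq cinner_self)
  ultimately show ?case by blast
qed

text \<open>
  Let \<open>T\<^sub>K\<close> map \<open>v\<^sub>j\<close> to \<open>\<surd>\<mu>\<^sub>j\<close> times the vector number \<open>\<sigma> j\<close> of an orthonormal family in the kernel of
  \<open>T\<^sub>F\<^sup>*\<close>. The kernel has room for as many such vectors as there are nonzero \<open>\<mu>\<^sub>j\<close>.
\<close>

lemma kernel_perturbation_with_spectrum:
  fixes F :: "'n::finite \<Rightarrow> complex^'d" and v :: "nat \<Rightarrow> complex^'d"
  assumes v: "orthonormal_basis v" and \<mu>: "\<And>j. j < CARD('d) \<Longrightarrow> 0 \<le> \<mu> j"
    and card: "card {j. j < CARD('d) \<and> \<mu> j \<noteq> 0} + CARD('d) \<le> CARD('n)"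
  obtains K :: "'n \<Rightarrow> complex^'d" where "cadjoint (analysis_op F) ** analysis_op K = 0"
    "frame_op K = spectral_sum v \<mu>"
proof -
  let ?d = "CARD('d)" and ?J = "{j. j < CARD('d) \<and> \<mu> j \<noteq> 0}"
  obtain y where y: "orthonormal_upto (card ?J) y" "\<And>j. j < card ?J \<Longrightarrow> cadjoint (analysis_op F) *v y j = 0"
    using orthonormal_in_kernel_exists[OF card, of "analysis_op F"] by blast
  obtain \<sigma> where \<sigma>: "bij_betw \<sigma> ?J {..<card ?J}"
    using finite_same_card_bij[of ?J "{..<card ?J}"] by auto
  have \<sigma>J: "\<sigma> j < card ?J" if "j \<in> ?J" for j using \<sigma> that by (auto simp: bij_betw_def)
  have y\<sigma>: "cinner (y (\<sigma> i)) (y (\<sigma> j)) = (if i = j then 1 else 0)" if "i \<in> ?J" "j \<in> ?J" for i j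
    using y(1) \<sigma>J that \<sigma> by (auto simp: orthonormal_upto_def bij_betw_def inj_on_def)
  define K :: "'n \<Rightarrow> complex^'d"
    where "K i = (\<Sum>j<?d. (complex_of_real (sqrt (\<mu> j)) * cnj (y (\<sigma> j) $ i)) *s v j)" for i
  have TK: "analysis_op K *v v l = complex_of_real (sqrt (\<mu> l)) *s y (\<sigma> l)" if l: "l < ?d" for l
  proof -
    have "(analysis_op K *v v l) $ i = (\<Sum>j<?d. if j = l then complex_of_real (sqrt (\<mu> l)) * y (\<sigma> l) $ i else 0)" for i
      unfolding analysis_op_mult K_def cinner_sum_right cinner_scale_right vec_lambda_beta
      using l by (intro sum.cong) (auto simp: orthonormal_basis_cinner[OF v])
    then show ?thesis using l by (simp add: vec_eq_iff)
  qed
  have "cadjoint (analysis_op F) ** analysis_op K = 0"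
  proof (rule matrix_eq_on_basis[OF v])
    fix l assume l: "l < ?d"
    have "complex_of_real (sqrt (\<mu> l)) *s (cadjoint (analysis_op F) *v y (\<sigma> l)) = 0"
      using y(2)[OF \<sigma>J, of l] l by (cases "\<mu> l = 0") auto
    then show "(cadjoint (analysis_op F) ** analysis_op K) *v v l = 0 *v v l"
      by (simp add: TK[OF l] vec.scale flip: matrix_vector_mul_assoc)
  qed
  moreover have "frame_op K = spectral_sum v \<mu>"
    unfolding eq_spectral_sum_iff[OF v]
  proof (intro allI impI vec_eq_on_basis[OF v])
    fix l j assume l: "l < ?d" and j: "j < ?d"
    have "cinner (frame_op K *v v l) (v j) = cinner (analysis_op K *v v l) (analysis_op K *v v j)"
      by (simp add: cinner_frame_op hermitian_cinner[OF hermitian_frame_op])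
    also have "\<dots> = complex_of_real (sqrt (\<mu> l) * sqrt (\<mu> j)) * cinner (y (\<sigma> l)) (y (\<sigma> j))"
      by (simp add: TK[OF l] TK[OF j] cinner_scale_left cinner_scale_right)
    also have "\<dots> = (if l = j then complex_of_real (\<mu> l) else 0)"
      using l j y\<sigma>[of l j] \<mu>[OF l] by (cases "\<mu> l = 0 \<or> \<mu> j = 0") (auto simp flip: of_real_mult)
    also have "\<dots> = cinner (complex_of_real (\<mu> l) *s v l) (v j)"
      using orthonormal_basis_cinner[OF v l j] by (simp add: cinner_scale_left)
    finally show "cinner (frame_op K *v v l) (v j) = cinner (complex_of_real (\<mu> l) *s v l) (v j)" .
  qed
  ultimately show ?thesis using that by blast
qed

lemma sum_opposed_sum:
  fixes A B :: "complex^'d^'d"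
  assumes A: "hermitian A" and B: "hermitian B"
  shows "sum_list (opposed_sum A B) = Re (trace (A + B))"
proof -
  have "sum_list (opposed_sum A B) = (\<Sum>i<CARD('d). eigvals A ! i) + (\<Sum>i<CARD('d). eigvals B ! (CARD('d) - 1 - i))"
    by (simp add: sum_list_sum_nth atLeast0LessThan opposed_sum_nth[OF A B] sum.distrib)
  also have "(\<Sum>i<CARD('d). eigvals B ! (CARD('d) - 1 - i)) = (\<Sum>i<CARD('d). eigvals B ! i)"
    by (rule sum.reindex_bij_betw[OF reversal_bij])
  finally show ?thesis by (simp add: sum_eigvals A B trace_add)
qed

text \<open>
  The spectral form of membership: the perturbation changes the spectrum of the canonical dual within
  the limits that define \<open>Lambda_set\<close>.
\<close>

lemma restricted_dual_cases:
  fixes F G :: "'n::finite \<Rightarrow> complex^'d"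
  assumes frame: "is_frame F" and eps: "0 < \<epsilon>" and G: "G \<in> restricted_duals t \<epsilon> F"
  obtains K where "G = (\<lambda>i. canonical_dual F i + K i)" "cadjoint (analysis_op F) ** analysis_op K = 0"
    "frame_op G = frame_op (canonical_dual F) + frame_op K"
    "opposed_sum (frame_op (canonical_dual F)) (frame_op K)
       \<in> Lambda_set t (\<epsilon>\<^sup>2) (eigvals (frame_op (canonical_dual F))) (2 * int CARD('d) - int CARD('n))"
proof -
  let ?d = "CARD('d)" and ?A = "frame_op (canonical_dual F)"
  define K where "K i = G i - canonical_dual F i" for i
  let ?B = "frame_op K"
  have GK: "G = (\<lambda>i. canonical_dual F i + K i)" by (simp add: K_def)
  have K0: "cadjoint (analysis_op F) ** analysis_op K = 0"
    using G unfolding dual_frame_iff[OF frame, symmetric] by (simp add: restricted_duals_def flip: GK)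
  have SG: "frame_op G = ?A + ?B" unfolding GK by (rule frame_op_dual[OF frame K0])
  have "analysis_op K = analysis_op G - analysis_op (canonical_dual F)"
    by (simp add: analysis_op_def vec_eq_iff K_def)
  then have "spectral_norm (analysis_op K) \<le> \<epsilon>" using G by (simp add: restricted_duals_def)
  then have TK: "norm (analysis_op K *v x) \<le> \<epsilon> * norm x" for x
    using spectral_norm_le_iff[of \<epsilon> "analysis_op K"] eps by simp
  obtain v where v: "orthonormal_basis v" "?B = spectral_sum v (\<lambda>j. eigvals ?B ! (?d - 1 - j))"
    using reversed_spectral_decomposition[OF hermitian_frame_op] .
  note lenA = length_eigvals[OF hermitian_frame_op[of "canonical_dual F"]]
  note lenB = length_eigvals[OF hermitian_frame_op[of K]]
  have revB: "rev (eigvals ?B) ! j = eigvals ?B ! (?d - 1 - j)" if "j < ?d" for j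
    using that by (simp add: rev_nth lenB)
  have bound: "eigvals ?B ! (?d - 1 - j) \<le> \<epsilon>\<^sup>2" if j: "j < ?d" for j
  proof -
    have "norm (v j) = 1" by (rule orthonormal_basis_norm[OF v(1) j])
    then have "(norm (analysis_op K *v v j))\<^sup>2 \<le> \<epsilon>\<^sup>2"
      using TK[of "v j"] by (intro power_mono) auto
    then show ?thesis using frame_op_eigvals_eq[OF v j] by simp
  qed
  have "opposed_sum ?A ?B \<in> Lambda_set t (\<epsilon>\<^sup>2) (eigvals ?A) (2 * int ?d - int CARD('n))"
  proof (rule Lambda_setI[of "rev (eigvals ?B)"])
    show "length (rev (eigvals ?B)) = length (eigvals ?A)" by (simp add: lenA lenB)
    show "opposed_sum ?A ?B = map2 (+) (eigvals ?A) (rev (eigvals ?B))" by (rule opposed_sum_def)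
    fix i assume "i < length (eigvals ?A)"
    then have i: "i < ?d" by (simp add: lenA)
    then have "eigvals ?B ! (?d - 1 - i) \<in> set (eigvals ?B)" by (simp add: lenB)
    then show "0 \<le> rev (eigvals ?B) ! i \<and> rev (eigvals ?B) ! i \<le> \<epsilon>\<^sup>2"
      unfolding revB[OF i] using bound[OF i] frame_op_eigvals_nonneg by blast
  next
    have "t \<le> (\<Sum>j\<in>UNIV. (norm (G j))\<^sup>2)" using G by (simp add: restricted_duals_def)
    also have "\<dots> = Re (trace (frame_op G))" by (simp add: trace_frame_op)
    also have "\<dots> = sum_list (opposed_sum ?A ?B)"
      by (simp add: sum_opposed_sum hermitian_frame_op SG)
    finally show "t \<le> sum_list (opposed_sum ?A ?B)" .
  next
    have "{j. j < length (eigvals ?A) \<and> rev (eigvals ?B) ! j \<noteq> 0}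
        = {j. j < ?d \<and> eigvals ?B ! (?d - 1 - j) \<noteq> 0}"
      using revB by (auto simp: lenA)
    then show "int (card {j. j < length (eigvals ?A) \<and> rev (eigvals ?B) ! j \<noteq> 0})
        \<le> int (length (eigvals ?A)) - (2 * int ?d - int CARD('n))"
      using card_nonzero_eigenvalues_le[OF frame K0 v] by (simp add: lenA)
  qed
  then show ?thesis using that GK K0 SG by blast
qed

text \<open>
  Take a perturbation that is diagonal in an eigenbasis of the frame operator of the canonical dual.
\<close>

lemma restricted_dual_exists:
  fixes F :: "'n::finite \<Rightarrow> complex^'d"
  assumes frame: "is_frame F" and eps: "0 < \<epsilon>"
    and \<rho>: "\<rho> \<in> Lambda_set t (\<epsilon>\<^sup>2) (eigvals (frame_op (canonical_dual F))) (2 * int CARD('d) - int CARD('n))"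
  obtains G where "G \<in> restricted_duals t \<epsilon> F" "eigvals (frame_op G) = decr \<rho>"
proof -
  let ?d = "CARD('d)" and ?A = "frame_op (canonical_dual F)"
  let ?lam = "eigvals ?A"
  note len = length_eigvals[OF hermitian_frame_op[of "canonical_dual F"]]
  obtain \<mu> where \<mu>: "length \<mu> = ?d" "length \<rho> = ?d" "\<rho> = map2 (+) ?lam \<mu>"
    "\<And>i. i < ?d \<Longrightarrow> 0 \<le> \<mu> ! i \<and> \<mu> ! i \<le> \<epsilon>\<^sup>2" "\<And>i. i < ?d \<Longrightarrow> \<rho> ! i = ?lam ! i + \<mu> ! i" "t \<le> sum_list \<rho>"
    "int (card {j. j < ?d \<and> \<mu> ! j \<noteq> 0}) \<le> int ?d - (2 * int ?d - int CARD('n))"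
    by (rule Lambda_setE[OF \<rho>, unfolded len], rule that; blast)
  obtain v where v: "orthonormal_basis v" "?A = spectral_sum v (\<lambda>j. ?lam ! j)"
    using spectral_decomposition[OF hermitian_frame_op] .
  have card: "card {j. j < ?d \<and> \<mu> ! j \<noteq> 0} + ?d \<le> CARD('n)" using \<mu>(7) by linarith
  obtain K :: "'n \<Rightarrow> complex^'d" where K: "cadjoint (analysis_op F) ** analysis_op K = 0"
      "frame_op K = spectral_sum v (\<lambda>j. \<mu> ! j)"
    using kernel_perturbation_with_spectrum[OF v(1) _ card, of F] \<mu>(4) by blast
  define G where "G i = canonical_dual F i + K i" for i
  have G: "G = (\<lambda>i. canonical_dual F i + K i)" by (rule ext) (rule G_def)
  have "frame_op G = ?A + frame_op K" unfolding G by (rule frame_op_dual[OF frame K(1)])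
  also have "\<dots> = spectral_sum v (\<lambda>j. ?lam ! j + \<mu> ! j)"
    unfolding spectral_sum_add K(2) v(2)[symmetric] ..
  also have "\<dots> = spectral_sum v (\<lambda>j. \<rho> ! j)"
    by (rule spectral_sum_cong) (simp add: \<mu>(5))
  finally have SG: "frame_op G = spectral_sum v (\<lambda>j. \<rho> ! j)" .
  have \<rho>map: "map (\<lambda>j. \<rho> ! j) [0..<?d] = \<rho>" using \<mu>(2) by (metis map_nth)
  have "norm (analysis_op K *v x) \<le> \<epsilon> * norm x" for x
  proof -
    have "(norm (analysis_op K *v x))\<^sup>2 = (\<Sum>j<?d. \<mu> ! j * (cmod (cinner x (v j)))\<^sup>2)"
      unfolding inner_frame_op[symmetric] K(2) by (rule inner_spectral_sum)
    also have "\<dots> \<le> (\<Sum>j<?d. \<epsilon>\<^sup>2 * (cmod (cinner x (v j)))\<^sup>2)"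
      using \<mu>(4) by (intro sum_mono mult_right_mono) auto
    also have "\<dots> = (\<epsilon> * norm x)\<^sup>2"
      unfolding power_mult_distrib parseval[OF v(1), of x] sum_distrib_left ..
    finally show ?thesis by (rule power2_le_imp_le) (use eps in simp)
  qed
  then have "spectral_norm (analysis_op K) \<le> \<epsilon>" using spectral_norm_le_iff[of \<epsilon> "analysis_op K"] eps by simp
  moreover have "analysis_op G - analysis_op (canonical_dual F) = analysis_op K"
    by (simp add: G analysis_op_add)
  moreover have "t \<le> (\<Sum>j\<in>UNIV. (norm (G j))\<^sup>2)"
  proof -
    have "complex_of_real (\<Sum>j\<in>UNIV. (norm (G j))\<^sup>2) = of_real (\<Sum>j<?d. \<rho> ! j)"
      unfolding trace_frame_op[symmetric] SG by (rule trace_spectral_sum[OF v(1)])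
    then have "(\<Sum>j\<in>UNIV. (norm (G j))\<^sup>2) = (\<Sum>j<?d. \<rho> ! j)" by (simp only: of_real_eq_iff)
    then show ?thesis using \<mu>(2,6) by (simp add: sum_list_sum_nth atLeast0LessThan)
  qed
  moreover have "G \<in> dual_frames F" unfolding G dual_frame_iff[OF frame] by (rule K(1))
  ultimately have "G \<in> restricted_duals t \<epsilon> F" by (simp add: restricted_duals_def)
  moreover have "eigvals (frame_op G) = decr \<rho>"
    unfolding SG eigvals_spectral_sum[OF v(1)] \<rho>map ..
  ultimately show ?thesis using that by blast
qed

section \<open>Optimal restricted dual frames\<close>

lemma convex_potential_eq:
  "mset (eigvals (frame_op G)) = mset \<rho> \<Longrightarrow> convex_potential h G = sum_list (map h \<rho>)"
  unfolding convex_potential_def by (rule sum_list_map_mset_cong)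

theorem corollary4p10:
  fixes F :: "'n::finite \<Rightarrow> complex^'d"
    and m :: int
    and \<epsilon> t :: real
    and lam \<rho> :: "real list"
    and h :: "real \<Rightarrow> real"
  assumes frame: "is_frame F"
    and m: "m = 2 * int CARD('d) - int CARD('n)"
    and eps: "\<epsilon> > 0"
    and t: "t > Re (trace (frame_op (canonical_dual F)))"
    and t_le: "t - Re (trace (frame_op (canonical_dual F)))
                 \<le> of_int (min (int CARD('d) - m) (int CARD('d))) * \<epsilon>\<^sup>2"
    and lam: "lam = eigvals (frame_op (canonical_dual F))"
    and rho: "\<rho> = rho_vec t (\<epsilon>\<^sup>2) lam m"
    and h_nonneg: "\<forall>x\<ge>0. h x \<ge> 0"
    and h_mono: "mono_on {0..} h"
    and h_convex: "convex_on {0..} h"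
  shows "(\<forall>G\<in>restricted_duals t \<epsilon> F. convex_potential h G \<ge> sum_list (map h \<rho>)) \<and>
    (\<exists>G\<in>restricted_duals t \<epsilon> F. convex_potential h G = sum_list (map h \<rho>)) \<and>
    (strictly_convex_on {0..} h \<longrightarrow>
      (\<forall>G\<in>restricted_duals t \<epsilon> F.
        convex_potential h G = sum_list (map h \<rho>) \<longleftrightarrow>
        (\<exists>K :: 'n \<Rightarrow> complex^'d.
           G = (\<lambda>i. canonical_dual F i + K i) \<and>
           cadjoint (analysis_op F) ** analysis_op K = 0 \<and>
           (\<exists>v. orthonormal_basis v \<and>
              frame_op (canonical_dual F) = (\<Sum>j<CARD('d). (lam ! j) *\<^sub>R tensor (v j) (v j)) \<and>
              frame_op K = (\<Sum>j<CARD('d). (\<rho> ! j - lam ! j) *\<^sub>R tensor (v j) (v j))))))"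
proof -
  let ?d = "CARD('d)" and ?A = "frame_op (canonical_dual F)"
  have herm: "hermitian ?A" by (rule hermitian_frame_op)
  have lenlam: "length lam = ?d" unfolding lam by (rule length_eigvals[OF herm])
  have lam0: "0 \<le> x" if "x \<in> set lam" for x using that frame_op_eigvals_nonneg unfolding lam by blast
  have sumlam: "sum_list lam = Re (trace ?A)"
    using sum_eigvals[OF herm] lenlam by (simp add: sum_list_sum_nth atLeast0LessThan lam)
  have opt: "optimal_spectrum t (\<epsilon>\<^sup>2) lam m \<rho>"
    unfolding rho
  proof (rule optimal_spectrum_rho_vec)
    show "sorted_wrt (\<ge>) lam" unfolding lam by (rule sorted_eigvals)
  qed (use eps t t_le lam0 in \<open>simp_all add: sumlam lenlam\<close>)
  then have \<rho>: "\<rho> \<in> Lambda_set t (\<epsilon>\<^sup>2) lam m" "sum_list \<rho> = t"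
    and min: "\<And>\<gamma>. \<gamma> \<in> Lambda_set t (\<epsilon>\<^sup>2) lam m \<Longrightarrow> submajorized \<rho> \<gamma>"
    by (auto simp: optimal_spectrum_def)
  obtain \<mu> where \<mu>: "length \<mu> = ?d" "length \<rho> = ?d" "\<rho> = map2 (+) lam \<mu>"
    "\<And>i. i < ?d \<Longrightarrow> 0 \<le> \<mu> ! i \<and> \<mu> ! i \<le> \<epsilon>\<^sup>2" "\<And>i. i < ?d \<Longrightarrow> \<rho> ! i = lam ! i + \<mu> ! i" "t \<le> sum_list \<rho>"
    "int (card {j. j < ?d \<and> \<mu> ! j \<noteq> 0}) \<le> int ?d - m"
    by (rule Lambda_setE[OF \<rho>(1), unfolded lenlam], rule that; blast)
  have \<rho>0: "0 \<le> x" if x: "x \<in> set \<rho>" for x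
  proof -
    obtain i where i: "i < ?d" "x = \<rho> ! i" using x by (auto simp: in_set_conv_nth \<mu>(2))
    have "0 \<le> lam ! i" using i(1) lenlam by (intro lam0) simp
    then show ?thesis using \<mu>(4,5)[OF i(1)] i(2) by simp
  qed
  have maj: "submajorized \<rho> (eigvals (?A + frame_op K))"
    if "opposed_sum ?A (frame_op K) \<in> Lambda_set t (\<epsilon>\<^sup>2) lam m" for K :: "'n \<Rightarrow> complex^'d"
    using submajorized_trans[OF min[OF that] lidskii_submajorization[OF herm hermitian_frame_op]] .
  note cases = restricted_dual_cases[OF frame eps, folded lam m]
  have lower: "sum_list (map h \<rho>) \<le> convex_potential h G" if "G \<in> restricted_duals t \<epsilon> F" for G
  proof (rule cases[OF that])
    fix K :: "'n \<Rightarrow> complex^'d"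
    assume K: "frame_op G = ?A + frame_op K" "opposed_sum ?A (frame_op K) \<in> Lambda_set t (\<epsilon>\<^sup>2) lam m"
    show ?thesis
      unfolding convex_potential_def
    proof (rule sum_le_if_submajorized(1)[OF _ h_mono h_convex])
      show "submajorized \<rho> (eigvals (frame_op G))" unfolding K(1) by (rule maj[OF K(2)])
    qed (use \<rho>0 frame_op_eigvals_nonneg in blast)+
  qed
  have attained: "\<exists>G\<in>restricted_duals t \<epsilon> F. convex_potential h G = sum_list (map h \<rho>)"
  proof -
    obtain G where "G \<in> restricted_duals t \<epsilon> F" "eigvals (frame_op G) = decr \<rho>"
      using restricted_dual_exists[OF frame eps \<rho>(1)[unfolded lam m]] .
    then show ?thesis using convex_potential_eq[of G \<rho>] by auto
  qed
  have char: "convex_potential h G = sum_list (map h \<rho>) \<longleftrightarrow>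
        (\<exists>K. G = (\<lambda>i. canonical_dual F i + K i) \<and> cadjoint (analysis_op F) ** analysis_op K = 0 \<and>
           (\<exists>v. orthonormal_basis v \<and> ?A = spectral_sum v (\<lambda>j. lam ! j) \<and>
              frame_op K = spectral_sum v (\<lambda>j. \<rho> ! j - lam ! j)))"
    (is "_ \<longleftrightarrow> (\<exists>K. ?P K)")
    if strict: "strictly_convex_on {0..} h" and G: "G \<in> restricted_duals t \<epsilon> F" for G
  proof
    assume "\<exists>K. ?P K"
    then obtain K v where K: "G = (\<lambda>i. canonical_dual F i + K i)" "cadjoint (analysis_op F) ** analysis_op K = 0"
      and v: "orthonormal_basis v" "?A = spectral_sum v (\<lambda>j. lam ! j)"
      "frame_op K = spectral_sum v (\<lambda>j. \<rho> ! j - lam ! j)" by blast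
    have "frame_op G = spectral_sum v (\<lambda>j. lam ! j + (\<rho> ! j - lam ! j))"
      unfolding K(1) frame_op_dual[OF frame K(2)] spectral_sum_add v(2)[symmetric] v(3) ..
    then have "eigvals (frame_op G) = decr (map (\<lambda>j. \<rho> ! j) [0..<?d])"
      using eigvals_spectral_sum[OF v(1)] by simp
    then have "mset (eigvals (frame_op G)) = mset \<rho>" using \<mu>(2) by (metis map_nth mset_decr)
    then show "convex_potential h G = sum_list (map h \<rho>)" by (rule convex_potential_eq)
  next
    assume eq: "convex_potential h G = sum_list (map h \<rho>)"
    show "\<exists>K. ?P K"
    proof (rule cases[OF G])
      fix K :: "'n \<Rightarrow> complex^'d"
    assume K: "G = (\<lambda>i. canonical_dual F i + K i)" "cadjoint (analysis_op F) ** analysis_op K = 0"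
        "frame_op G = ?A + frame_op K" "opposed_sum ?A (frame_op K) \<in> Lambda_set t (\<epsilon>\<^sup>2) lam m"
      let ?\<gamma> = "opposed_sum ?A (frame_op K)"
      have ms: "mset \<rho> = mset (eigvals (?A + frame_op K))"
        using eq \<rho>0 frame_op_eigvals_nonneg[of _ G]
        by (intro sum_le_if_submajorized(2)[OF maj[OF K(4)] h_mono h_convex _ _ strict])
          (auto simp: convex_potential_def K(3))
      have "submajorized ?\<gamma> \<rho>"
        using lidskii_submajorization[OF herm hermitian_frame_op[of K]] ms
        unfolding submajorized_iff_hinge_sum by (metis hinge_sum_mset_cong mset_eq_length)
      then have ms\<gamma>: "mset ?\<gamma> = mset \<rho>" using min[OF K(4)] by (rule submajorized_antisym)
      obtain v where v: "orthonormal_basis v" "?A = spectral_sum v (\<lambda>j. eigvals ?A ! j)"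
        "frame_op K = spectral_sum v (\<lambda>j. rev (eigvals (frame_op K)) ! j)"
        using lidskii_equality[OF herm hermitian_frame_op] ms\<gamma> ms by metis
      have lenB: "length (eigvals (frame_op K)) = ?d" by (rule length_eigvals[OF hermitian_frame_op])
      have "map2 (-) ?\<gamma> lam = rev (eigvals (frame_op K))"
        using lenlam lenB by (intro nth_equalityI) (auto simp: opposed_sum_def lam)
      moreover have "sorted (rev (eigvals (frame_op K)))"
        using sorted_eigvals[of "frame_op K"] by (simp add: sorted_wrt_rev)
      moreover have "submajorized ?\<gamma> \<gamma>" if "\<gamma> \<in> Lambda_set t (\<epsilon>\<^sup>2) lam m" for \<gamma>
        using min[OF that] ms\<gamma> unfolding submajorized_iff_hinge_sum
        by (metis hinge_sum_mset_cong mset_eq_length)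
      moreover have "sum_list ?\<gamma> = t" using \<rho>(2) ms\<gamma> by (metis sum_mset_sum_list)
      ultimately have "optimal_spectrum t (\<epsilon>\<^sup>2) lam m ?\<gamma>"
        using K(4) by (simp add: optimal_spectrum_def)
      then have "\<rho> = ?\<gamma>" using optimal_spectrum_unique[OF opt _ lam0] by blast
      then have diff: "rev (eigvals (frame_op K)) ! j = \<rho> ! j - lam ! j" if "j < ?d" for j
        using that lenlam lenB by (simp add: opposed_sum_def lam)
      have "frame_op K = spectral_sum v (\<lambda>j. \<rho> ! j - lam ! j)"
        using v(3) spectral_sum_cong[of "\<lambda>j. rev (eigvals (frame_op K)) ! j" "\<lambda>j. \<rho> ! j - lam ! j" v] diff by metis
      then show "\<exists>K. ?P K" using K(1,2) v(1,2) unfolding lam by blast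
    qed
  qed
  show ?thesis
    using lower attained char unfolding spectral_sum_def by blast
qed

end
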